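(* Let $\nu$ be fixed with $\Re(\nu)>-1$, let $a<b$, $f,g\in C^{\infty}[a,b]$ with $g'(x)\neq0$ for $x\in[a,b]$, and assume $g(\xi)=0$ for some $\xi\in[a,b]$ and $g(x)\neq0$ for $x\in[a,b]\setminus\{\xi\}$. Let $\mathcal{H}_\nu[f]=\int_a^b f(x)J_\nu(\omega g(x))\,dx$ and $M(\nu,\omega)=\int_a^bJ_\nu(\omega g(x))\,dx$. Define $\widetilde\sigma_0[f]=f$ and for $k\ge1$ $$\widetilde\sigma_k[f](x)=g(x)^{\nu+k}\frac{d}{dx}\left[\frac{\widetilde\sigma_{k-1}[f](x)-\widetilde\sigma_{k-1}[f](\xi)}{g(x)^{\nu+k}g'(x)}\right],$$ with the value at $x=\xi$ understood as the limit $x\to\xi$. Then, as $\omega\to\infty$, $$\mathcal{H}_\nu[f]\sim\sum_{k=0}^\infty\frac{\widetilde\sigma_k[f](\xi)}{(-\omega)^k}M(\nu+k,\omega)-\sum_{k=1}^\infty\frac{1}{(-\omega)^k}\left\{\frac{\widetilde\sigma_{k-1}[f](b)-\widetilde\sigma_{k-1}[f](\xi)}{g'(b)}J_{\nu+k}(\omega g(b))-\frac{\widetilde\sigma_{k-1}[f](a)-\widetilde\sigma_{k-1}[f](\xi)}{g'(a)}J_{\nu+k}(\omega g(a))\right\}.$$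
   Context: $J_\nu$ is the Bessel function of the first kind of order $\nu$; $\sim$ denotes an asymptotic expansion as $\omega\to\infty$. *)

theory Defs
  imports "HOL-Analysis.Analysis" "HOL-Library.Landau_Symbols"
begin

definition smooth_on_interval :: "(real \<Rightarrow> real) \<Rightarrow> real set \<Rightarrow> bool" where
  "smooth_on_interval f S \<longleftrightarrow>
     (\<exists>D :: nat \<Rightarrow> real \<Rightarrow> real. (\<forall>x\<in>S. D 0 x = f x) \<and>
        (\<forall>k. \<forall>x\<in>S. (D k has_real_derivative D (Suc k) x) (at x within S)))"

text \<open>Bessel function of the first kind, principal branch:
  J_nu(z) = (z/2)^nu * sum_m (-z^2/4)^m / (m! Gamma(nu+m+1)).
  At z = 0 we use the value of the limit when it exists for Re nu \<ge> 0 (1 if nu = 0, else 0).\<close>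
definition bessel_J :: "complex \<Rightarrow> complex \<Rightarrow> complex" where
  "bessel_J \<nu> z =
     (if z = 0 then (if \<nu> = 0 then 1 else 0)
      else (z / 2) powr \<nu> *
           (\<Sum>m. (- (z\<^sup>2 / 4)) ^ m * rGamma (\<nu> + of_nat m + 1) / of_nat (fact m)))"

definition dI :: "(real \<Rightarrow> real) \<Rightarrow> real \<Rightarrow> real \<Rightarrow> real \<Rightarrow> real" where
  "dI g a b x = vector_derivative g (at x within {a..b})"

primrec sigmaT :: "complex \<Rightarrow> (real \<Rightarrow> real) \<Rightarrow> (real \<Rightarrow> real) \<Rightarrow> real \<Rightarrow> real \<Rightarrow> real
                    \<Rightarrow> nat \<Rightarrow> real \<Rightarrow> complex" where
  "sigmaT \<nu> f g a b \<xi> 0 = (\<lambda>x. complex_of_real (f x))"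
| "sigmaT \<nu> f g a b \<xi> (Suc k) =
     (let s = sigmaT \<nu> f g a b \<xi> k;
          \<mu> = \<nu> + of_nat (Suc k);
          r = (\<lambda>x. (complex_of_real (g x)) powr \<mu> *
                 vector_derivative
                   (\<lambda>y. (s y - s \<xi>) / ((complex_of_real (g y)) powr \<mu> * complex_of_real (dI g a b y)))
                   (at x within {a..b}))
      in (\<lambda>x. if x = \<xi> then Lim (at \<xi> within ({a..b} - {\<xi>})) r else r x))"

definition Hnu :: "complex \<Rightarrow> (real \<Rightarrow> real) \<Rightarrow> (real \<Rightarrow> real) \<Rightarrow> real \<Rightarrow> real \<Rightarrow> real \<Rightarrow> complex" where
  "Hnu \<nu> f g a b \<omega> = integral {a..b} (\<lambda>x. complex_of_real (f x) * bessel_J \<nu> (complex_of_real (\<omega> * g x)))"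

definition Mnu :: "complex \<Rightarrow> (real \<Rightarrow> real) \<Rightarrow> real \<Rightarrow> real \<Rightarrow> real \<Rightarrow> complex" where
  "Mnu \<nu> g a b \<omega> = integral {a..b} (\<lambda>x. bessel_J \<nu> (complex_of_real (\<omega> * g x)))"

end

theory Submission
  imports Defs
begin

text \<open>Away from \<open>\<xi>\<close>, the identity \<open>(t\<^bsup>\<mu>+1\<^esup> J\<^bsub>\<mu>+1\<^esub>(t))' = t\<^bsup>\<mu>+1\<^esup> J\<^bsub>\<mu>\<^esub>(t)\<close>
  shows that \<open>\<omega> (\<sigma>\<^bsub>k\<^esub> - \<sigma>\<^bsub>k\<^esub>(\<xi>)) J\<^bsub>\<nu>+k\<^esub>(\<omega> g) + \<sigma>\<^bsub>k+1\<^esub> J\<^bsub>\<nu>+k+1\<^esub>(\<omega> g)\<close> is the derivative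
  of \<open>(\<sigma>\<^bsub>k\<^esub> - \<sigma>\<^bsub>k\<^esub>(\<xi>)) J\<^bsub>\<nu>+k+1\<^esub>(\<omega> g) / g'\<close>, a function that is continuous on the whole interval.
  Iterating this integration by parts gives the expansion with an exact remainder, equal to
  \<open>(-\<omega>)\<^bsup>-(N+1)\<^esup>\<close> times an integral against \<open>J\<^bsub>\<nu>+N+1\<^esub>(\<omega> g)\<close> and a boundary term. These are
  \<open>O(\<omega>\<^bsup>-1/2\<^esup>)\<close> because \<open>\<bar>J\<^bsub>\<mu>\<^esub>(t)\<bar> \<le> K \<bar>t\<bar>\<^bsup>-1/2\<^esup>\<close> for \<open>Re \<mu> > 0\<close>, \<open>\<bar>g(x)\<bar> \<ge> c \<bar>x - \<xi>\<bar>\<close>, and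
  \<open>\<bar>x - \<xi>\<bar>\<^bsup>-1/2\<^esup>\<close> is integrable.\<close>

section \<open>Smooth functions on an interval\<close>

text \<open>The derivative is chosen existentially at each order and the values may be complex, so
  closure under arithmetic follows by induction on the order. One-sided derivatives at the endpoints
  are covered by \<open>at x within S\<close>.\<close>

primrec Ck_on :: "nat \<Rightarrow> (real \<Rightarrow> 'a::real_normed_vector) \<Rightarrow> real set \<Rightarrow> bool" where
  "Ck_on 0 f S \<longleftrightarrow> continuous_on S f"
| "Ck_on (Suc n) f S \<longleftrightarrow>
     (\<exists>f'. (\<forall>x\<in>S. (f has_vector_derivative f' x) (at x within S)) \<and> Ck_on n f' S)"

definition smooth_on :: "(real \<Rightarrow> 'a::real_normed_vector) \<Rightarrow> real set \<Rightarrow> bool" where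
  "smooth_on f S \<longleftrightarrow> (\<forall>n. Ck_on n f S)"

lemma Ck_on_imp_continuous_on: "Ck_on n f S \<Longrightarrow> continuous_on S f"
  by (cases n) (auto simp: continuous_on_eq_continuous_within intro: has_vector_derivative_continuous)

lemma Ck_on_cong:
  assumes "Ck_on n f S" "\<And>x. x \<in> S \<Longrightarrow> f x = g x"
  shows "Ck_on n g S"
proof (cases n)
  case 0
  then show ?thesis using assms continuous_on_cong by force
next
  case (Suc m)
  with assms(1) obtain f' where "\<forall>x\<in>S. (f has_vector_derivative f' x) (at x within S)" "Ck_on m f' S"
    by auto
  then show ?thesis using Suc assms(2)
    by (auto intro!: exI[of _ f'] has_vector_derivative_transform[of _ S g f])
qed

lemma Ck_on_Suc_imp: "Ck_on (Suc n) f S \<Longrightarrow> Ck_on n f S"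
proof (induction n arbitrary: f)
  case 0
  then show ?case using Ck_on_imp_continuous_on Ck_on.simps(1) by blast
next
  case (Suc n)
  then show ?case by (metis Ck_on.simps(2))
qed

lemma Ck_on_const: "Ck_on n (\<lambda>_. c) S"
proof (induction n arbitrary: c)
  case (Suc n)
  then show ?case by (auto intro!: exI[of _ "\<lambda>_. 0"])
qed simp

lemma Ck_on_add: "Ck_on n f S \<Longrightarrow> Ck_on n g S \<Longrightarrow> Ck_on n (\<lambda>x. f x + g x) S"
proof (induction n arbitrary: f g)
  case (Suc n)
  then obtain f' g' where
    "\<forall>x\<in>S. (f has_vector_derivative f' x) (at x within S)" "Ck_on n f' S"
    "\<forall>x\<in>S. (g has_vector_derivative g' x) (at x within S)" "Ck_on n g' S"
    by auto
  with Suc.IH[of f' g'] show ?case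
    by (auto intro!: exI[of _ "\<lambda>x. f' x + g' x"] has_vector_derivative_add)
qed (auto intro: continuous_intros)

lemma Ck_on_mult:
  fixes f g :: "real \<Rightarrow> 'a::real_normed_algebra"
  shows "Ck_on n f S \<Longrightarrow> Ck_on n g S \<Longrightarrow> Ck_on n (\<lambda>x. f x * g x) S"
proof (induction n arbitrary: f g)
  case (Suc n)
  from Suc.prems obtain f' g' where
    "\<forall>x\<in>S. (f has_vector_derivative f' x) (at x within S)" "Ck_on n f' S"
    "\<forall>x\<in>S. (g has_vector_derivative g' x) (at x within S)" "Ck_on n g' S"
    by auto
  moreover have "Ck_on n f S" "Ck_on n g S"
    using Suc.prems Ck_on_Suc_imp by blast+
  ultimately show ?case using Suc.IH
    by (auto intro!: exI[of _ "\<lambda>x. f x * g' x + f' x * g x"] has_vector_derivative_mult Ck_on_add)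
qed (auto intro: continuous_intros)

lemma has_vector_derivative_inverse:
  fixes f :: "real \<Rightarrow> 'a::real_normed_field"
  assumes "(f has_vector_derivative f') (at x within S)" "f x \<noteq> 0"
  shows "((\<lambda>x. inverse (f x)) has_vector_derivative - (f' * inverse (f x) * inverse (f x))) (at x within S)"
  using Deriv.has_derivative_inverse[OF assms(2) assms(1)[unfolded has_vector_derivative_def]]
  unfolding has_vector_derivative_def
  by (simp add: algebra_simps)

lemma Ck_on_inverse:
  fixes f :: "real \<Rightarrow> 'a::real_normed_field"
  shows "Ck_on n f S \<Longrightarrow> (\<And>x. x \<in> S \<Longrightarrow> f x \<noteq> 0) \<Longrightarrow> Ck_on n (\<lambda>x. inverse (f x)) S"
proof (induction n)
  case (Suc n)
  from Suc.prems obtain f' where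
    f': "\<forall>x\<in>S. (f has_vector_derivative f' x) (at x within S)" "Ck_on n f' S"
    by auto
  have "Ck_on n (\<lambda>x. inverse (f x)) S"
    using Suc Ck_on_Suc_imp by blast
  then have "Ck_on n (\<lambda>x. (- 1) * (f' x * inverse (f x) * inverse (f x))) S"
    by (intro Ck_on_mult Ck_on_const f')
  then show ?case using f' Suc.prems(2)
    by (auto intro!: exI[of _ "\<lambda>x. - (f' x * inverse (f x) * inverse (f x))"]
        has_vector_derivative_inverse)
qed (auto intro: continuous_intros)

lemma smooth_on_imp_continuous_on: "smooth_on f S \<Longrightarrow> continuous_on S f"
  unfolding smooth_on_def using Ck_on_imp_continuous_on by blast

lemma smooth_on_cong: "smooth_on f S \<Longrightarrow> (\<And>x. x \<in> S \<Longrightarrow> f x = g x) \<Longrightarrow> smooth_on g S"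
  unfolding smooth_on_def using Ck_on_cong by blast

lemma smooth_on_const: "smooth_on (\<lambda>_. c) S"
  unfolding smooth_on_def using Ck_on_const by blast

lemma smooth_on_mult:
  fixes f g :: "real \<Rightarrow> 'a::real_normed_algebra"
  shows "smooth_on f S \<Longrightarrow> smooth_on g S \<Longrightarrow> smooth_on (\<lambda>x. f x * g x) S"
  unfolding smooth_on_def using Ck_on_mult by blast

lemma smooth_on_diff:
  fixes f g :: "real \<Rightarrow> 'a::real_normed_algebra_1"
  assumes "smooth_on f S" "smooth_on g S"
  shows "smooth_on (\<lambda>x. f x - g x) S"
proof -
  have "smooth_on (\<lambda>x. f x + (- 1) * g x) S"
    using assms unfolding smooth_on_def by (intro allI Ck_on_add Ck_on_mult Ck_on_const) auto
  then show ?thesis by simp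
qed

lemma smooth_on_divide:
  fixes f g :: "real \<Rightarrow> 'a::real_normed_field"
  assumes "smooth_on f S" "smooth_on g S" "\<And>x. x \<in> S \<Longrightarrow> g x \<noteq> 0"
  shows "smooth_on (\<lambda>x. f x / g x) S"
  using assms unfolding smooth_on_def divide_inverse by (intro allI Ck_on_mult Ck_on_inverse) auto

text \<open>Each order supplies its own derivative, but derivatives within a nondegenerate closed
  interval are unique. The witnesses therefore agree on it, and a single one is smooth of every
  order.\<close>

lemma smooth_on_Icc_derivative:
  fixes f :: "real \<Rightarrow> 'a::real_normed_vector"
  assumes "a < b" "smooth_on f {a..b}"
  obtains f' where "\<And>x. x \<in> {a..b} \<Longrightarrow> (f has_vector_derivative f' x) (at x within {a..b})"
    and "smooth_on f' {a..b}"
proof -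
  have "\<forall>n. \<exists>f'. (\<forall>x\<in>{a..b}. (f has_vector_derivative f' x) (at x within {a..b})) \<and> Ck_on n f' {a..b}"
    using assms(2) unfolding smooth_on_def by (metis Ck_on.simps(2))
  then obtain F where F: "\<And>n x. x \<in> {a..b} \<Longrightarrow> (f has_vector_derivative F n x) (at x within {a..b})"
      "\<And>n. Ck_on n (F n) {a..b}"
    by metis
  have "F n x = F 0 x" if "x \<in> {a..b}" for n x
    using vector_derivative_unique_within_closed_interval[of a b x f "F n x" "F 0 x"] F that assms
    by (simp add: cbox_interval)
  then have "smooth_on (F 0) {a..b}"
    unfolding smooth_on_def using F(2) Ck_on_cong by (metis (no_types, lifting))
  with F(1) show ?thesis using that by blast
qed

section \<open>Dividing a smooth function by \<open>x - \<xi>\<close>\<close>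

lemma convex_combination_Icc:
  fixes \<xi> x a b t :: real
  assumes "\<xi> \<in> {a..b}" "x \<in> {a..b}" "t \<in> {0..1}"
  shows "\<xi> + t * (x - \<xi>) \<in> {a..b}"
proof -
  have "(1 - t) *\<^sub>R \<xi> + t *\<^sub>R x \<in> {a..b}"
    using assms by (intro convexD) auto
  then show ?thesis by (simp add: algebra_simps)
qed

text \<open>Each differentiation under the integral sign replaces \<open>p\<close> by its derivative
  and produces one more factor \<open>t\<close>. The weight \<open>t ^ j\<close> is there so that
  the induction closes.\<close>

lemma Ck_on_moment:
  fixes p :: "real \<Rightarrow> 'a::banach"
  assumes "\<xi> \<in> {a..b}" "Ck_on n p {a..b}"
  shows "Ck_on n (\<lambda>x. integral {0..1} (\<lambda>t. t ^ j *\<^sub>R p (\<xi> + t * (x - \<xi>)))) {a..b}"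
  using assms(2)
proof (induction n arbitrary: p j)
  have cont: "continuous_on ({a..b} \<times> cbox 0 1) (\<lambda>(x,t). t ^ j *\<^sub>R p (\<xi> + t * (x - \<xi>)))"
    if "continuous_on {a..b} p" for p :: "real \<Rightarrow> 'a" and j
    unfolding split_beta
    by (intro continuous_intros continuous_on_compose2[OF that])
       (use convex_combination_Icc[OF assms(1)] in auto)
  {
    case 0
    then show ?case
      using integral_continuous_on_param[OF cont, of p j] by simp
  next
    case (Suc n)
    from Suc.prems obtain p' where
      p': "\<And>x. x \<in> {a..b} \<Longrightarrow> (p has_vector_derivative p' x) (at x within {a..b})" "Ck_on n p' {a..b}"
      unfolding Ck_on.simps by blast
    have cp: "continuous_on {a..b} p" "continuous_on {a..b} p'"
      using Suc.prems p'(2) Ck_on_imp_continuous_on by blast+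
    have "((\<lambda>x. integral (cbox 0 1) (\<lambda>t. t ^ j *\<^sub>R p (\<xi> + t * (x - \<xi>)))) has_vector_derivative
           integral (cbox 0 1) (\<lambda>t. t ^ Suc j *\<^sub>R p' (\<xi> + t * (x - \<xi>)))) (at x within {a..b})"
      if x: "x \<in> {a..b}" for x
    proof (rule leibniz_rule_vector_derivative)
      fix y t :: real assume yt: "y \<in> {a..b}" "t \<in> cbox 0 1"
      have 1: "((\<lambda>y. \<xi> + t * (y - \<xi>)) has_vector_derivative t) (at y within {a..b})"
          by (auto intro!: derivative_eq_intros simp flip: has_real_derivative_iff_has_vector_derivative)
      have 2: "(p has_vector_derivative p' (\<xi> + t * (y - \<xi>)))
          (at (\<xi> + t * (y - \<xi>)) within (\<lambda>y. \<xi> + t * (y - \<xi>)) ` {a..b})"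
          using convex_combination_Icc[OF assms(1)] yt
          by (intro has_vector_derivative_within_subset[OF p'(1)]) auto
      have "((\<lambda>y. p (\<xi> + t * (y - \<xi>))) has_vector_derivative t *\<^sub>R p' (\<xi> + t * (y - \<xi>))) (at y within {a..b})"
        using vector_diff_chain_within[OF 1 2] by (simp add: o_def)
      from has_vector_derivative_scaleR[OF DERIV_const this, of "t ^ j"]
      show "((\<lambda>y. t ^ j *\<^sub>R p (\<xi> + t * (y - \<xi>))) has_vector_derivative
          t ^ Suc j *\<^sub>R p' (\<xi> + t * (y - \<xi>))) (at y within {a..b})"
        by (simp add: mult_ac)
    next
      fix y :: real assume y: "y \<in> {a..b}"
      have "continuous_on (cbox 0 1) (\<lambda>t. t ^ j *\<^sub>R p (\<xi> + t * (y - \<xi>)))"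
        by (intro continuous_intros continuous_on_compose2[OF cp(1)])
           (use convex_combination_Icc[OF assms(1)] y in auto)
      then show "(\<lambda>t. t ^ j *\<^sub>R p (\<xi> + t * (y - \<xi>))) integrable_on cbox 0 1"
        by (rule integrable_continuous)
    qed (use x cont[OF cp(2), of "Suc j"] in auto)
    then show ?case
      using Suc.IH[OF p'(2), of "Suc j"] unfolding Ck_on.simps cbox_interval
      by (intro exI[of _ "\<lambda>x. integral {0..1} (\<lambda>t. t ^ Suc j *\<^sub>R p' (\<xi> + t * (x - \<xi>)))"] conjI ballI)
  }
qed

text \<open>Hadamard's lemma: \<open>H x\<close> is the mean of h' over the segment from \<xi> to
  \<open>x\<close>, that is, the moment integral with \<open>j = 0\<close>. The last conclusion
  identifies \<open>H \<xi>\<close>, which later shows that the cofactor of \<open>g\<close> does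
  not vanish at \<xi>.\<close>

lemma smooth_on_factor_zero:
  fixes h :: "real \<Rightarrow> 'a::{real_normed_field,banach}"
  assumes "a < b" "\<xi> \<in> {a..b}" "smooth_on h {a..b}" "h \<xi> = 0"
  obtains H where "smooth_on H {a..b}" "\<And>x. x \<in> {a..b} \<Longrightarrow> h x = of_real (x - \<xi>) * H x"
    "(h has_vector_derivative H \<xi>) (at \<xi> within {a..b})"
proof -
  obtain h' where h': "\<And>x. x \<in> {a..b} \<Longrightarrow> (h has_vector_derivative h' x) (at x within {a..b})"
      and sm: "smooth_on h' {a..b}"
    using smooth_on_Icc_derivative assms by blast
  define H where "H = (\<lambda>x. integral {0..1} (\<lambda>t. h' (\<xi> + t * (x - \<xi>))))"
  have "smooth_on H {a..b}"
    using Ck_on_moment[OF assms(2), of _ h' 0] sm unfolding smooth_on_def H_def by simp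
  moreover have "h x = of_real (x - \<xi>) * H x" if x: "x \<in> {a..b}" for x
  proof -
    have "((\<lambda>t. (x - \<xi>) *\<^sub>R h' (\<xi> + t * (x - \<xi>))) has_integral
        (h (\<xi> + 1 * (x - \<xi>)) - h (\<xi> + 0 * (x - \<xi>)))) {0..1}"
    proof (rule fundamental_theorem_of_calculus)
      fix t :: real assume t: "t \<in> {0..1}"
      have 1: "((\<lambda>t. \<xi> + t * (x - \<xi>)) has_vector_derivative (x - \<xi>)) (at t within {0..1})"
          by (auto intro!: derivative_eq_intros simp flip: has_real_derivative_iff_has_vector_derivative)
      have 2: "(h has_vector_derivative h' (\<xi> + t * (x - \<xi>)))
          (at (\<xi> + t * (x - \<xi>)) within (\<lambda>t. \<xi> + t * (x - \<xi>)) ` {0..1})"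
          using convex_combination_Icc[OF assms(2) x] t
          by (intro has_vector_derivative_within_subset[OF h']) auto
      show "((\<lambda>t. h (\<xi> + t * (x - \<xi>))) has_vector_derivative (x - \<xi>) *\<^sub>R h' (\<xi> + t * (x - \<xi>)))
         (at t within {0..1})"
        using vector_diff_chain_within[OF 1 2] by (simp add: o_def)
    qed auto
    from integral_unique[OF this]
    have "(x - \<xi>) *\<^sub>R integral {0..1} (\<lambda>t. h' (\<xi> + t * (x - \<xi>))) = h x"
      using assms(4) by simp
    then show ?thesis unfolding H_def by (simp add: scaleR_conv_of_real)
  qed
  moreover have "H \<xi> = h' \<xi>" unfolding H_def by simp
  ultimately show ?thesis using that h' assms(2) by metis
qed

section \<open>Bessel functions on the real line\<close>

text \<open>The entire factor of the Bessel function, with J_mu(t) = (t/2)^mu F_mu(t^2/4); it is the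
  Bessel-Clifford function at \<open>- w\<close>. All branch issues are confined to the
  power.\<close>

definition bessel_F :: "complex \<Rightarrow> complex \<Rightarrow> complex" where
  "bessel_F \<mu> w = (\<Sum>m. ((- 1) ^ m * rGamma (\<mu> + of_nat m + 1) / of_nat (fact m)) * w ^ m)"

text \<open>In rGamma(z) = z rGamma(z + 1) the factor z has norm at least 1 once the index passes
  \<open>M\<close>, so the norms no longer increase. The maximum over the initial segment bounds
  them all.\<close>

lemma rGamma_shift_bounded: "\<exists>K. \<forall>m. norm (rGamma (\<mu> + of_nat m + 1 :: complex)) \<le> K"
proof -
  obtain M :: nat where M: "norm \<mu> \<le> real M" using real_arch_simple by blast
  define K where "K = Max ((\<lambda>m. norm (rGamma (\<mu> + of_nat m + 1))) ` {..M})"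
  have "norm (rGamma (\<mu> + of_nat m + 1)) \<le> K" for m
  proof (induction m)
    case 0
    then show ?case unfolding K_def by (intro Max_ge) (auto intro!: image_eqI[of _ _ 0])
  next
    case (Suc m)
    show ?case
    proof (cases "Suc m \<le> M")
      case True
      then show ?thesis unfolding K_def by (intro Max_ge imageI) auto
    next
      case False
      have "real m + 1 = norm (of_nat m + 1 :: complex)" by (metis norm_of_nat of_nat_Suc add.commute)
      also have "\<dots> \<le> norm (\<mu> + of_nat m + 1) + norm \<mu>"
        using norm_triangle_ineq4[of "\<mu> + of_nat m + 1" \<mu>] by (simp add: add.commute add.left_commute)
      finally have 1: "1 \<le> norm (\<mu> + of_nat m + 1)" using False M by simp
      have "norm (rGamma (\<mu> + of_nat (Suc m) + 1)) \<le> norm (\<mu> + of_nat m + 1) * norm (rGamma (\<mu> + of_nat (Suc m) + 1))"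
        using mult_right_mono[OF 1, of "norm (rGamma (\<mu> + of_nat (Suc m) + 1))"] by simp
      also have "\<dots> = norm (rGamma (\<mu> + of_nat m + 1))"
        using rGamma_plus1[of "\<mu> + of_nat m + 1"] by (simp add: norm_mult [symmetric] add_ac)
      finally show ?thesis using Suc.IH by simp
    qed
  qed
  then show ?thesis by blast
qed

lemma bessel_F_summable:
  "summable (\<lambda>m. ((- 1) ^ m * rGamma (\<mu> + of_nat m + 1) / of_nat (fact m)) * (w::complex) ^ m)"
proof -
  obtain K where K: "\<And>m. norm (rGamma (\<mu> + of_nat m + 1)) \<le> K"
    using rGamma_shift_bounded by blast
  have s: "summable (\<lambda>m. K * (norm w ^ m /\<^sub>R fact m))"
    by (intro summable_mult summable_exp_generic)
  show ?thesis
  proof (rule summable_comparison_test'[OF s])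
    fix m
    have "norm (((- 1) ^ m * rGamma (\<mu> + of_nat m + 1) / of_nat (fact m)) * w ^ m)
      = norm (rGamma (\<mu> + of_nat m + 1)) * (norm w ^ m /\<^sub>R fact m)"
      by (simp add: norm_mult norm_divide norm_power divide_inverse norm_inverse)
    also have "\<dots> \<le> K * (norm w ^ m /\<^sub>R fact m)"
      by (intro mult_right_mono K) auto
    finally show "norm (((- 1) ^ m * rGamma (\<mu> + of_nat m + 1) / of_nat (fact m)) * w ^ m)
      \<le> K * (norm w ^ m /\<^sub>R fact m)" .
  qed
qed

text \<open>Termwise differentiation: the factor m + 1 cancels against the factorial, the shifted
  index amounts to raising \<mu> by 1, and one sign is left over.\<close>

lemma bessel_F_deriv: "(bessel_F \<mu> has_field_derivative - bessel_F (\<mu> + 1) w) (at w)"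
proof -
  let ?c = "\<lambda>\<mu> m. (- 1) ^ m * rGamma (\<mu> + of_nat m + 1) / of_nat (fact m) :: complex"
  have eq: "diffs (?c \<mu>) = (\<lambda>m. - ?c (\<mu> + 1) m)"
  proof
    fix m
    have "of_nat (Suc m) \<noteq> (0::complex)" by (rule of_nat_neq_0)
    moreover have e: "\<mu> + 1 + of_nat m + 1 = \<mu> + of_nat (Suc m) + 1" by simp
    moreover have f: "(of_nat (fact (Suc m)) :: complex) = of_nat (Suc m) * of_nat (fact m)"
      by (simp add: algebra_simps)
    ultimately show "diffs (?c \<mu>) m = - ?c (\<mu> + 1) m"
      unfolding diffs_def e f by (simp del: of_nat_Suc)
  qed
  have "(bessel_F \<mu> has_field_derivative (\<Sum>m. diffs (?c \<mu>) m * w ^ m)) (at w)"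
    unfolding bessel_F_def [abs_def]
    by (intro termdiffs_strong_converges_everywhere bessel_F_summable)
  also have "(\<Sum>m. diffs (?c \<mu>) m * w ^ m) = - bessel_F (\<mu> + 1) w"
    unfolding eq bessel_F_def using suminf_minus[OF bessel_F_summable, of "\<mu> + 1" w] by simp
  finally show ?thesis .
qed

text \<open>Comparison of coefficients. The functional equation of \<open>rGamma\<close> produces
  the factor \<mu> + m + 1; its part \<mu> + 1 gives the first term, and its part m cancels against
  the factorial and gives the second after an index shift.\<close>

lemma bessel_F_recurrence: "bessel_F \<mu> w = (\<mu> + 1) * bessel_F (\<mu> + 1) w - w * bessel_F (\<mu> + 2) w"
proof -
  let ?c = "\<lambda>\<mu> m. (- 1) ^ m * rGamma (\<mu> + of_nat m + 1) / of_nat (fact m) :: complex"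
  have "(\<lambda>m. w * (?c (\<mu> + 2) m * w ^ m)) sums (w * bessel_F (\<mu> + 2) w)"
    unfolding bessel_F_def by (intro sums_mult summable_sums bessel_F_summable)
  moreover have "w * (?c (\<mu> + 2) m * w ^ m) = - (of_nat (Suc m) * ?c (\<mu> + 1) (Suc m) * w ^ Suc m)" for m
  proof -
    have "of_nat (Suc m) \<noteq> (0::complex)" by (rule of_nat_neq_0)
    moreover have e: "\<mu> + 2 + of_nat m + 1 = \<mu> + 1 + of_nat (Suc m) + 1" by simp
    moreover have f: "(of_nat (fact (Suc m)) :: complex) = of_nat (Suc m) * of_nat (fact m)"
      by (simp add: algebra_simps)
    ultimately show ?thesis unfolding e f by (simp del: of_nat_Suc)
  qed
  ultimately have "(\<lambda>m. of_nat (Suc m) * ?c (\<mu> + 1) (Suc m) * w ^ Suc m) sums (- (w * bessel_F (\<mu> + 2) w))"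
    using sums_minus by fastforce
  \<comment> \<open>The term with m = 0 vanishes, so the series can start there with the same
    sum.\<close>
  then have 1: "(\<lambda>m. of_nat m * ?c (\<mu> + 1) m * w ^ m) sums (- (w * bessel_F (\<mu> + 2) w))"
    by (subst (asm) sums_Suc_iff) simp
  have 2: "(\<lambda>m. (\<mu> + 1) * (?c (\<mu> + 1) m * w ^ m)) sums ((\<mu> + 1) * bessel_F (\<mu> + 1) w)"
    unfolding bessel_F_def by (intro sums_mult summable_sums bessel_F_summable)
  have "(\<mu> + 1) * (?c (\<mu> + 1) m * w ^ m) + of_nat m * ?c (\<mu> + 1) m * w ^ m = ?c \<mu> m * w ^ m" for m
  proof -
    have "rGamma (\<mu> + of_nat m + 1) = (\<mu> + of_nat m + 1) * rGamma (\<mu> + 1 + of_nat m + 1)"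
      using rGamma_plus1[of "\<mu> + of_nat m + 1"] by (simp add: add_ac)
    then show ?thesis by (simp add: field_simps)
  qed
  then have "(\<lambda>m. ?c \<mu> m * w ^ m) sums ((\<mu> + 1) * bessel_F (\<mu> + 1) w + - (w * bessel_F (\<mu> + 2) w))"
    using sums_add[OF 2 1] by simp
  then show ?thesis unfolding bessel_F_def[of \<mu>] by (simp add: sums_iff)
qed

section \<open>Powers and Bessel functions of a real variable: derivatives and recurrences\<close>

lemma of_real_powr_complex:
  "x \<noteq> 0 \<Longrightarrow> complex_of_real x powr \<mu> = exp (\<mu> * (of_real (ln \<bar>x\<bar>) + (if x < 0 then pi else 0) * \<i>))"
  by (simp add: powr_def Ln_of_real')

text \<open>The principal power is discontinuous across the negative axis, but along the real line
  its argument is constant on each open half-line. There it is the exponential of an affine function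
  of ln |t|.\<close>

lemma has_vector_derivative_of_real_powr:
  assumes "t \<noteq> 0"
  shows "((\<lambda>t. complex_of_real t powr \<mu>) has_vector_derivative \<mu> * of_real t powr \<mu> / of_real t) (at t)"
proof -
  \<comment> \<open>The branch constant is frozen at its value at \<open>t\<close>; the resulting
    formula agrees with the power on the whole half-line \<open>S\<close> around
    \<open>t\<close>.\<close>
  define d where "d = (if t < 0 then pi else 0) * \<i>"
  have "((\<lambda>x. exp (\<mu> * (of_real (ln \<bar>x\<bar>) + d))) has_vector_derivative
      exp (\<mu> * (of_real (ln \<bar>t\<bar>) + d)) * (\<mu> * (of_real (1 / t)))) (at t)"
  proof -
    have "((\<lambda>x. ln \<bar>x\<bar>) has_real_derivative 1 / t) (at t)"
    proof (cases "t > 0")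
      case True
      have "(ln has_real_derivative 1 / t) (at t)"
        using DERIV_ln_divide[OF True] .
      then show ?thesis
        by (rule has_field_derivative_transform_within_open[where S = "{0<..}"]) (use True in auto)
    next
      case False
      with assms have "t < 0" by simp
      then have "((\<lambda>x. ln (- x)) has_real_derivative 1 / t) (at t)"
        by (auto intro!: derivative_eq_intros)
      then show ?thesis
        by (rule has_field_derivative_transform_within_open[where S = "{..<0}"]) (use \<open>t < 0\<close> in auto)
    qed
    then have "((\<lambda>x. complex_of_real (ln \<bar>x\<bar>)) has_vector_derivative of_real (1 / t)) (at t)"
      by (intro has_vector_derivative_of_real) (simp add: has_real_derivative_iff_has_vector_derivative)
    then have "((\<lambda>x. \<mu> * (of_real (ln \<bar>x\<bar>) + d)) has_vector_derivative \<mu> * of_real (1 / t)) (at t)"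
      using has_vector_derivative_add_const[of "\<lambda>x. of_real (ln \<bar>x\<bar>)" d]
      by (intro has_vector_derivative_mult_right) simp
    from field_vector_diff_chain_at[OF this DERIV_exp] show ?thesis by (simp add: o_def mult.commute)
  qed
  moreover have "exp (\<mu> * (of_real (ln \<bar>t\<bar>) + d)) = of_real t powr \<mu>"
    using assms by (simp add: of_real_powr_complex d_def)
  ultimately have D: "((\<lambda>x. exp (\<mu> * (of_real (ln \<bar>x\<bar>) + d))) has_vector_derivative
      \<mu> * of_real t powr \<mu> / of_real t) (at t)"
    by (simp add: mult_ac)
  define S :: "real set" where "S = (if t < 0 then {..<0} else {0<..})"
  show ?thesis
  proof (rule has_vector_derivative_transform_within_open[OF D])
    show "open S" "t \<in> S" using assms by (auto simp: S_def)
    show "exp (\<mu> * (of_real (ln \<bar>x\<bar>) + d)) = complex_of_real x powr \<mu>" if "x \<in> S" for x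
      using that by (subst of_real_powr_complex) (auto simp: S_def d_def split: if_splits)
  qed
qed

lemma bessel_J_of_real:
  assumes "t \<noteq> 0"
  shows "bessel_J \<mu> (of_real t) = of_real (t / 2) powr \<mu> * bessel_F \<mu> (of_real (t\<^sup>2 / 4))"
proof -
  have X: "(- ((complex_of_real t)\<^sup>2 / 4)) ^ m * r / of_nat (fact m)
      = ((- 1) ^ m * r / of_nat (fact m)) * of_real (t\<^sup>2 / 4) ^ m" for r m
    by (subst power_minus) simp
  show ?thesis using assms unfolding bessel_J_def bessel_F_def X by simp
qed

text \<open>Product rule: differentiating the power gives \<mu>/t times the function itself, and
  differentiating the entire factor brings out t/2, which raises the power to \<mu> + 1.\<close>

lemma has_vector_derivative_bessel_J:
  assumes "t \<noteq> 0"
  shows "((\<lambda>t. bessel_J \<mu> (of_real t)) has_vector_derivative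
     \<mu> / of_real t * bessel_J \<mu> (of_real t) - bessel_J (\<mu> + 1) (of_real t)) (at t)"
proof -
  have 1: "((\<lambda>t::real. t / 2) has_vector_derivative 1/2) (at t)"
    by (auto intro!: derivative_eq_intros simp flip: has_real_derivative_iff_has_vector_derivative)
  have p: "((\<lambda>t. complex_of_real (t / 2) powr \<mu>) has_vector_derivative
      \<mu> / of_real t * of_real (t / 2) powr \<mu>) (at t)"
    using vector_diff_chain_at[OF 1 has_vector_derivative_of_real_powr, of \<mu>] assms
    by (simp add: o_def scaleR_conv_of_real)
  have 2: "((\<lambda>t. complex_of_real (t\<^sup>2 / 4)) has_vector_derivative of_real (t / 2)) (at t)"
    by (intro has_vector_derivative_of_real)
       (auto intro!: derivative_eq_intros simp flip: has_real_derivative_iff_has_vector_derivative)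
  have F: "((\<lambda>t. bessel_F \<mu> (of_real (t\<^sup>2 / 4))) has_vector_derivative
      of_real (t / 2) * - bessel_F (\<mu> + 1) (of_real (t\<^sup>2 / 4))) (at t)"
    using field_vector_diff_chain_at[OF 2 bessel_F_deriv, of \<mu>] by (simp add: o_def)
  have e: "complex_of_real (t / 2) powr (\<mu> + 1) = of_real (t / 2) powr \<mu> * of_real (t / 2)"
    using assms by (simp add: powr_add)
  have "((\<lambda>t. of_real (t / 2) powr \<mu> * bessel_F \<mu> (of_real (t\<^sup>2 / 4))) has_vector_derivative
     \<mu> / of_real t * bessel_J \<mu> (of_real t) - bessel_J (\<mu> + 1) (of_real t)) (at t)"
    using has_vector_derivative_mult[OF p F] assms unfolding bessel_J_of_real[OF assms] e
    by (simp add: algebra_simps)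
  then show ?thesis
    by (rule has_vector_derivative_transform_within_open[of _ _ _ "- {0}"]) (use assms in \<open>auto simp: bessel_J_of_real\<close>)
qed

lemma bessel_J_recurrence:
  assumes "t \<noteq> 0"
  shows "bessel_J \<mu> (of_real t) + bessel_J (\<mu> + 2) (of_real t)
    = 2 * (\<mu> + 1) / of_real t * bessel_J (\<mu> + 1) (of_real t)"
proof -
  define p where "p = complex_of_real (t / 2) powr \<mu>"
  have e: "complex_of_real (t / 2) powr (\<mu> + 1) = p * of_real (t / 2)"
     "complex_of_real (t / 2) powr (\<mu> + 2) = p * of_real (t / 2) * of_real (t / 2)"
    unfolding p_def using assms powr_add[of "complex_of_real (t/2)" \<mu> 2]
    by (simp_all add: powr_add power2_eq_square)
  show ?thesis
    using assms unfolding bessel_J_of_real[OF assms] e p_def[symmetric] bessel_F_recurrence[of \<mu>]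
    by (simp add: field_simps power2_eq_square)
qed

text \<open>The recurrence eliminates the order \<mu> + 2 from the previous derivative formula. This
  is the identity for the derivative of t^(mu+1) J_(mu+1) with the power divided out, the form used
  for integration by parts.\<close>

lemma has_vector_derivative_bessel_J':
  assumes "t \<noteq> 0"
  shows "((\<lambda>t. bessel_J (\<mu> + 1) (of_real t)) has_vector_derivative
     bessel_J \<mu> (of_real t) - (\<mu> + 1) / of_real t * bessel_J (\<mu> + 1) (of_real t)) (at t)"
proof -
  have "bessel_J (\<mu> + 2) (of_real t) = 2 * (\<mu> + 1) / of_real t * bessel_J (\<mu> + 1) (of_real t) - bessel_J \<mu> (of_real t)"
    using bessel_J_recurrence[OF assms, of \<mu>] by (simp add: algebra_simps)
  then have h: "(\<mu> + 1) / of_real t * bessel_J (\<mu> + 1) (of_real t) - bessel_J (\<mu> + 1 + 1) (of_real t)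
      = bessel_J \<mu> (of_real t) - (\<mu> + 1) / of_real t * bessel_J (\<mu> + 1) (of_real t)"
    by (simp add: add.assoc)
  show ?thesis
    using has_vector_derivative_bessel_J[OF assms, of "\<mu> + 1"] unfolding h .
qed

section \<open>Continuity at zero, reflection and decay of Bessel functions\<close>

lemma continuous_bessel_J:
  assumes "Re \<mu> > 0"
  shows "continuous_on UNIV (\<lambda>t. bessel_J \<mu> (of_real t))"
proof -
  have "isCont (\<lambda>t. bessel_J \<mu> (of_real t)) t" for t
  proof (cases "t = 0")
    case False
    then show ?thesis using has_vector_derivative_bessel_J has_vector_derivative_continuous by blast
  next
    case True
    \<comment> \<open>Positivity of Re \<mu> makes the power tend to 0 from both sides, while the
      entire factor stays finite. The limit matches the default value of \<open>bessel_J\<close> at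
      0.\<close>
    have "((\<lambda>t. complex_of_real (t / 2) powr \<mu>) \<longlongrightarrow> 0) (at 0)"
      by (rule tendsto_powr_complex_0[OF _ tendsto_const assms]) (auto intro!: tendsto_eq_intros)
    moreover have "((\<lambda>t. bessel_F \<mu> (of_real (t\<^sup>2 / 4))) \<longlongrightarrow> bessel_F \<mu> 0) (at 0)"
      using bessel_F_deriv[of \<mu> 0, THEN DERIV_isCont]
      by (intro isCont_tendsto_compose[of _ "bessel_F \<mu>"]) (auto intro!: tendsto_eq_intros)
    ultimately have "((\<lambda>t. of_real (t / 2) powr \<mu> * bessel_F \<mu> (of_real (t\<^sup>2 / 4))) \<longlongrightarrow> 0 * bessel_F \<mu> 0) (at 0)"
      by (rule tendsto_mult)
    moreover have "eventually (\<lambda>t. of_real (t / 2) powr \<mu> * bessel_F \<mu> (of_real (t\<^sup>2 / 4)) = bessel_J \<mu> (of_real t)) (at 0)"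
      by (auto simp: eventually_at_filter bessel_J_of_real)
    ultimately have "((\<lambda>t. bessel_J \<mu> (of_real t)) \<longlongrightarrow> 0) (at 0)"
      unfolding mult_zero_left by (rule Lim_transform_eventually)
    moreover have "bessel_J \<mu> (of_real 0) = 0" using assms by (auto simp: bessel_J_def)
    ultimately show ?thesis using True by (simp add: isCont_def)
  qed
  then show ?thesis by (simp add: continuous_on_eq_continuous_at)
qed

text \<open>The entire factor depends on t^2 only, so the sign change affects just the principal
  power, whose argument jumps from 0 to pi.\<close>

lemma bessel_J_minus:
  assumes "t > 0"
  shows "bessel_J \<mu> (of_real (- t)) = exp (\<mu> * of_real pi * \<i>) * bessel_J \<mu> (of_real t)"
proof -
  have "complex_of_real (- t / 2) powr \<mu> = exp (\<mu> * of_real pi * \<i>) * of_real (t / 2) powr \<mu>"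
    using assms by (subst (1 2) of_real_powr_complex) (auto simp: algebra_simps exp_add)
  then show ?thesis using assms by (subst (1 2) bessel_J_of_real) auto
qed

text \<open>The function \<open>sqrt t * J\<^sub>\<mu>(t)\<close> solves \<open>A'' = (c / t\<^sup>2 - 1) A\<close>
  with \<open>c = \<mu>\<^sup>2 - 1/4\<close>, so its energy \<open>E = \<bar>A\<bar>\<^sup>2 + \<bar>A'\<bar>\<^sup>2\<close> satisfies \<open>E' \<le> (\<bar>c\<bar> / t\<^sup>2) E\<close>,
  and the right-hand side coefficient is integrable at infinity.\<close>

lemma bessel_J_sqrt_bounded:
  "\<exists>K. \<forall>t\<ge>1. norm (of_real (sqrt t) * bessel_J \<mu> (of_real t)) \<le> K"
proof -
  define c where "c = \<mu>\<^sup>2 - 1/4"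
  define A where "A = (\<lambda>t. complex_of_real (sqrt t) * bessel_J \<mu> (of_real t))"
  \<comment> \<open>This is the derivative of \<open>A\<close> in closed form, so that the energy
    needs no second-order calculus.\<close>
  define V where "V = (\<lambda>t. (\<mu> + 1/2) / of_real t * A t - of_real (sqrt t) * bessel_J (\<mu> + 1) (of_real t))"
  have sq: "((\<lambda>t. complex_of_real (sqrt t)) has_vector_derivative of_real (sqrt t) / (2 * of_real t)) (at t)"
    if "t > 0" for t
  proof -
    have "(sqrt has_real_derivative sqrt t / (2 * t)) (at t)"
      using that by (auto intro!: derivative_eq_intros simp: field_simps)
    then have "((\<lambda>t. complex_of_real (sqrt t)) has_vector_derivative of_real (sqrt t / (2 * t))) (at t)"
      by (intro has_vector_derivative_of_real) (simp add: has_real_derivative_iff_has_vector_derivative)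
    then show ?thesis by simp
  qed
  have dA: "(A has_vector_derivative V t) (at t)" if "t > 0" for t
    using has_vector_derivative_mult[OF sq[OF that] has_vector_derivative_bessel_J, of \<mu>] that
    unfolding A_def V_def by (simp add: field_simps)
  have dV: "(V has_vector_derivative (c / of_real (t\<^sup>2) - 1) * A t) (at t)" if "t > 0" for t
  proof -
    have i: "((\<lambda>t. (\<mu> + 1/2) / complex_of_real t) has_vector_derivative - ((\<mu> + 1/2) / of_real (t\<^sup>2))) (at t)"
    proof -
      have "((\<lambda>t. 1 / t) has_real_derivative - (1 / t\<^sup>2)) (at t)"
        using that by (auto intro!: derivative_eq_intros simp: field_simps power2_eq_square)
      then have "((\<lambda>t. complex_of_real (1 / t)) has_vector_derivative of_real (- (1 / t\<^sup>2))) (at t)"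
        by (intro has_vector_derivative_of_real) (simp add: has_real_derivative_iff_has_vector_derivative)
      from has_vector_derivative_mult_right[OF this, of "\<mu> + 1/2"] show ?thesis by simp
    qed
    have "(V has_vector_derivative
        ((\<mu> + 1/2) / of_real t * V t + - ((\<mu> + 1/2) / of_real (t\<^sup>2)) * A t)
      - (of_real (sqrt t) * (bessel_J \<mu> (of_real t) - (\<mu> + 1) / of_real t * bessel_J (\<mu> + 1) (of_real t))
         + of_real (sqrt t) / (2 * of_real t) * bessel_J (\<mu> + 1) (of_real t))) (at t)"
      unfolding V_def
      by (intro has_vector_derivative_diff has_vector_derivative_mult i dA[unfolded V_def] sq
          has_vector_derivative_bessel_J') (use that in auto)
    moreover have "((\<mu> + 1/2) / of_real t * V t + - ((\<mu> + 1/2) / of_real (t\<^sup>2)) * A t)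
      - (of_real (sqrt t) * (bessel_J \<mu> (of_real t) - (\<mu> + 1) / of_real t * bessel_J (\<mu> + 1) (of_real t))
         + of_real (sqrt t) / (2 * of_real t) * bessel_J (\<mu> + 1) (of_real t)) = (c / of_real (t\<^sup>2) - 1) * A t"
      using that unfolding V_def A_def c_def
      by (simp add: field_simps power2_eq_square)
    ultimately show ?thesis by simp
  qed
  \<comment> \<open>The energy is multiplied by an integrating factor whose logarithmic derivative
    -|c|/t^2 offsets the largest possible growth, so the product is nonincreasing.\<close>
  define E where "E = (\<lambda>t. (A t \<bullet> A t + V t \<bullet> V t) * exp (norm c / t))"
  have E_le: "E t \<le> E 1" if "t \<ge> 1" for t
  proof (rule DERIV_nonpos_imp_nonincreasing[OF that])
    fix s :: real assume "1 \<le> s" "s \<le> t"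
    then have s: "s > 0" by simp
    define e where "e = exp (norm c / s)"
    have e: "((\<lambda>t. exp (norm c / t)) has_real_derivative - (norm c / s\<^sup>2) * e) (at s)"
      unfolding e_def using s by (auto intro!: derivative_eq_intros simp: power2_eq_square)
    have q: "((\<lambda>t. A t \<bullet> A t + V t \<bullet> V t) has_real_derivative
        (2 * (A s \<bullet> V s) + 2 * (V s \<bullet> ((c / of_real (s\<^sup>2) - 1) * A s)))) (at s)"
      using has_derivative_add[OF
        has_derivative_inner[OF dA[OF s, unfolded has_vector_derivative_def] dA[OF s, unfolded has_vector_derivative_def]]
        has_derivative_inner[OF dV[OF s, unfolded has_vector_derivative_def] dV[OF s, unfolded has_vector_derivative_def]]]
      unfolding has_field_derivative_def
      by (simp add: inner_commute algebra_simps mult_commute_abs)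
    let ?d = "(A s \<bullet> A s + V s \<bullet> V s) * (- (norm c / s\<^sup>2) * e)
       + (2 * (A s \<bullet> V s) + 2 * (V s \<bullet> ((c / of_real (s\<^sup>2) - 1) * A s))) * e"
    have d: "(E has_real_derivative ?d) (at s)"
      unfolding E_def using DERIV_mult'[OF q e] by (simp add: e_def)
    \<comment> \<open>The part -A of the second derivative cancels the cross term of the oscillator;
      only the perturbation c/s^2 remains.\<close>
    have "2 * (A s \<bullet> V s) + 2 * (V s \<bullet> ((c / of_real (s\<^sup>2) - 1) * A s)) = 2 * (V s \<bullet> (c / of_real (s\<^sup>2) * A s))"
      by (simp add: left_diff_distrib inner_diff_right inner_commute)
    also have "\<dots> \<le> 2 * (norm (V s) * (norm c / s\<^sup>2 * norm (A s)))"
      using norm_cauchy_schwarz[of "V s" "c / of_real (s\<^sup>2) * A s"] by (simp add: norm_mult norm_divide norm_power)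
    also have "\<dots> = norm c / s\<^sup>2 * (2 * norm (A s) * norm (V s))" by simp
    also have "\<dots> \<le> norm c / s\<^sup>2 * (A s \<bullet> A s + V s \<bullet> V s)"
      using sum_squares_bound[of "norm (A s)" "norm (V s)"]
      by (intro mult_left_mono) (auto simp: power2_norm_eq_inner)
    finally have "?d \<le> (A s \<bullet> A s + V s \<bullet> V s) * (- (norm c / s\<^sup>2) * e) + norm c / s\<^sup>2 * (A s \<bullet> A s + V s \<bullet> V s) * e"
      by (intro add_left_mono mult_right_mono) (auto simp: e_def)
    then have "?d \<le> 0" by (simp add: algebra_simps)
    with d show "\<exists>y. (E has_real_derivative y) (at s) \<and> y \<le> 0" by blast
  qed
  have "norm (A t) \<le> sqrt (E 1)" if "t \<ge> 1" for t
  proof -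
    have "(norm (A t))\<^sup>2 \<le> (A t \<bullet> A t + V t \<bullet> V t) * 1"
      by (simp add: power2_norm_eq_inner)
    also have "\<dots> \<le> E t" unfolding E_def using that by (intro mult_left_mono) auto
    also have "\<dots> \<le> E 1" by (rule E_le[OF that])
    finally show ?thesis by (simp add: real_le_rsqrt)
  qed
  then show ?thesis unfolding A_def by blast
qed

text \<open>Three regimes: the energy estimate for t at least 1, compactness of [0, 1] with
  continuity, and reflection for negative t.\<close>

lemma bessel_J_bound:
  assumes "Re \<mu> > 0"
  obtains K where "K \<ge> 0" "\<And>t. t \<noteq> 0 \<Longrightarrow> norm (bessel_J \<mu> (of_real t)) \<le> K / sqrt \<bar>t\<bar>"
proof -
  obtain K1 where K1: "\<And>t. t \<ge> 1 \<Longrightarrow> norm (of_real (sqrt t) * bessel_J \<mu> (of_real t)) \<le> K1"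
    using bessel_J_sqrt_bounded by blast
  have "continuous_on {0..1} (\<lambda>t. of_real (sqrt t) * bessel_J \<mu> (of_real t))"
    by (intro continuous_intros continuous_on_subset[OF continuous_bessel_J[OF assms]]) auto
  then have "bounded ((\<lambda>t. of_real (sqrt t) * bessel_J \<mu> (of_real t)) ` {0..1})"
    by (intro compact_imp_bounded compact_continuous_image) auto
  then obtain K2 where K2: "\<And>t. t \<in> {0..1} \<Longrightarrow> norm (of_real (sqrt t) * bessel_J \<mu> (of_real t)) \<le> K2"
    unfolding bounded_iff by blast
  define K where "K = max K1 K2"
  \<comment> \<open>The reflection factor has norm exp(-pi Im \<mu>), which may lie on either side
    of 1; the maximum serves both signs of \<open>t\<close>.\<close>
  define L where "L = max 1 (norm (exp (\<mu> * of_real pi * \<i>)))"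
  have K: "norm (of_real (sqrt t) * bessel_J \<mu> (of_real t)) \<le> K" if "t \<ge> 0" for t
    using K1[of t] K2[of t] that unfolding K_def by (cases "t \<ge> 1") auto
  from K[of 0] have K0: "K \<ge> 0" by simp
  have pos: "norm (bessel_J \<mu> (of_real t)) \<le> K / sqrt t" if "t > 0" for t
    using K[of t] that by (simp add: norm_mult field_simps)
  show ?thesis
  proof (rule that[of "L * K"])
    show "0 \<le> L * K" using K0 by (simp add: L_def)
    fix t :: real assume t: "t \<noteq> 0"
    show "norm (bessel_J \<mu> (of_real t)) \<le> L * K / sqrt \<bar>t\<bar>"
    proof (cases "t > 0")
      case True
      have "1 * (K / sqrt t) \<le> L * (K / sqrt t)"
        using K0 True by (intro mult_right_mono) (auto simp: L_def)
      with pos[OF True] True show ?thesis by simp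
    next
      case False
      with t have "- t > 0" by simp
      have "norm (bessel_J \<mu> (of_real (- (- t)))) = norm (exp (\<mu> * of_real pi * \<i>)) * norm (bessel_J \<mu> (of_real (- t)))"
        by (subst bessel_J_minus[OF \<open>- t > 0\<close>]) (rule norm_mult)
      also have "\<dots> \<le> L * (K / sqrt (- t))"
        using pos[OF \<open>- t > 0\<close>] by (intro mult_mono) (auto simp: L_def)
      finally show ?thesis using False by simp
    qed
  qed
qed

section \<open>Integration by parts with a vanishing phase\<close>

lemma smooth_on_interval_imp_Ck_on:
  assumes "\<forall>k. \<forall>x\<in>S. (D k has_real_derivative D (Suc k) x) (at x within S)"
  shows "Ck_on n (\<lambda>x. complex_of_real (D k x)) S"
proof -
  have *: "((\<lambda>x. complex_of_real (D k x)) has_vector_derivative of_real (D (Suc k) x)) (at x within S)"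
    if "x \<in> S" for k x
    using assms that by (intro has_vector_derivative_of_real)
      (auto simp: has_real_derivative_iff_has_vector_derivative)
  show ?thesis
  proof (induction n arbitrary: k)
    case 0
    show ?case unfolding Ck_on.simps by (rule continuous_on_vector_derivative) (rule *)
  next
    case (Suc n)
    show ?case unfolding Ck_on.simps
      by (intro exI[of _ "\<lambda>x. complex_of_real (D (Suc k) x)"] conjI ballI * Suc)
  qed
qed

text \<open>Transfers the real hypotheses to complex-valued smoothness. The first derivative in the
  given sequence equals \<open>dI\<close> by uniqueness of derivatives within the interval.\<close>

lemma smooth_on_interval_derivative:
  assumes "a < b" "smooth_on_interval f {a..b}"
  shows "smooth_on (\<lambda>x. complex_of_real (f x)) {a..b}"
    and "smooth_on (\<lambda>x. complex_of_real (dI f a b x)) {a..b}"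
    and "x \<in> {a..b} \<Longrightarrow> (f has_vector_derivative dI f a b x) (at x within {a..b})"
proof -
  from assms(2) obtain D where D0: "\<forall>x\<in>{a..b}. D 0 x = f x"
      and D: "\<forall>k. \<forall>x\<in>{a..b}. (D k has_real_derivative D (Suc k) x) (at x within {a..b})"
    unfolding smooth_on_interval_def by blast
  have der: "(f has_vector_derivative D 1 x) (at x within {a..b})" if "x \<in> {a..b}" for x
    using D D0 that
    by (intro has_vector_derivative_transform[of x "{a..b}" f "D 0"])
       (auto simp flip: has_real_derivative_iff_has_vector_derivative)
  then have eq: "dI f a b x = D 1 x" if "x \<in> {a..b}" for x
    unfolding dI_def using vector_derivative_within_closed_interval assms(1) that by blast
  show "smooth_on (\<lambda>x. complex_of_real (f x)) {a..b}"
    by (rule smooth_on_cong[of "\<lambda>x. complex_of_real (D 0 x)"])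
       (use D0 smooth_on_interval_imp_Ck_on[OF D] in \<open>auto simp: smooth_on_def\<close>)
  show "smooth_on (\<lambda>x. complex_of_real (dI f a b x)) {a..b}"
    by (rule smooth_on_cong[of "\<lambda>x. complex_of_real (D 1 x)"])
       (use eq smooth_on_interval_imp_Ck_on[OF D] in \<open>auto simp: smooth_on_def\<close>)
  show "(f has_vector_derivative dI f a b x) (at x within {a..b})" if "x \<in> {a..b}"
    using der eq that by simp
qed

section \<open>The phase and its simple zero\<close>

locale bessel_phase =
  fixes a b \<xi> :: real and g :: "real \<Rightarrow> real"
  assumes ab: "a < b"
    and smooth_g: "smooth_on_interval g {a..b}"
    and g'_nz: "\<And>x. x \<in> {a..b} \<Longrightarrow> dI g a b x \<noteq> 0"
    and \<xi>: "\<xi> \<in> {a..b}"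
    and g_zero: "g \<xi> = 0"
    and g_nz: "\<And>x. x \<in> {a..b} \<Longrightarrow> x \<noteq> \<xi> \<Longrightarrow> g x \<noteq> 0"
begin

abbreviation g' :: "real \<Rightarrow> complex" where "g' x \<equiv> complex_of_real (dI g a b x)"

lemmas smooth_cg = smooth_on_interval_derivative(1)[OF ab smooth_g]
  and smooth_g' = smooth_on_interval_derivative(2)[OF ab smooth_g]
  and g_deriv = smooth_on_interval_derivative(3)[OF ab smooth_g]

lemma continuous_on_g: "continuous_on {a..b} g"
  by (rule continuous_on_vector_derivative) (rule g_deriv)

text \<open>The zero of \<open>g\<close> is simple: the cofactor at \<xi> equals the derivative of
  \<open>g\<close> there, and elsewhere it is nonzero because \<open>g\<close> is.\<close>

lemma g_factor:
  obtains G where "smooth_on G {a..b}" "\<And>x. x \<in> {a..b} \<Longrightarrow> G x \<noteq> 0"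
    "\<And>x. x \<in> {a..b} \<Longrightarrow> complex_of_real (g x) = of_real (x - \<xi>) * G x"
proof -
  obtain G where G: "smooth_on G {a..b}"
      "\<And>x. x \<in> {a..b} \<Longrightarrow> complex_of_real (g x) = of_real (x - \<xi>) * G x"
      "((\<lambda>x. complex_of_real (g x)) has_vector_derivative G \<xi>) (at \<xi> within {a..b})"
    using smooth_on_factor_zero[OF ab \<xi> smooth_cg] g_zero by (metis of_real_0)
  have "((\<lambda>x. complex_of_real (g x)) has_vector_derivative g' \<xi>) (at \<xi> within {a..b})"
    using g_deriv[OF \<xi>]
    by (intro has_vector_derivative_of_real) (simp add: has_real_derivative_iff_has_vector_derivative)
  then have "G \<xi> = g' \<xi>"
    using vector_derivative_unique_within_closed_interval[of a b \<xi>] G(3) ab \<xi> by (simp add: cbox_interval)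
  then have "G x \<noteq> 0" if "x \<in> {a..b}" for x
    using g'_nz[OF \<xi>] g_nz[OF that] G(2)[OF that] by (cases "x = \<xi>") auto
  with G that show ?thesis by blast
qed

text \<open>The constant is the minimum over the compact interval of the norm of the nonvanishing
  cofactor.\<close>

lemma g_lower_bound:
  obtains c where "c > 0" "\<And>x. x \<in> {a..b} \<Longrightarrow> c * \<bar>x - \<xi>\<bar> \<le> \<bar>g x\<bar>"
proof -
  obtain G where G: "smooth_on G {a..b}" "\<And>x. x \<in> {a..b} \<Longrightarrow> G x \<noteq> 0"
    "\<And>x. x \<in> {a..b} \<Longrightarrow> complex_of_real (g x) = of_real (x - \<xi>) * G x"
    using g_factor by blast
  have "continuous_on {a..b} (\<lambda>x. norm (G x))"
    by (intro continuous_intros smooth_on_imp_continuous_on G)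
  then obtain x0 where x0: "x0 \<in> {a..b}" "\<And>x. x \<in> {a..b} \<Longrightarrow> norm (G x0) \<le> norm (G x)"
    using continuous_attains_inf[of "{a..b}" "\<lambda>x. norm (G x)"] ab by auto
  have "norm (G x0) * \<bar>x - \<xi>\<bar> \<le> \<bar>g x\<bar>" if "x \<in> {a..b}" for x
  proof -
    have "\<bar>g x\<bar> = norm (complex_of_real (g x))" by simp
    also have "\<dots> = \<bar>x - \<xi>\<bar> * norm (G x)"
      unfolding G(3)[OF that] norm_mult by (simp del: of_real_diff)
    finally show ?thesis using mult_left_mono[OF x0(2)[OF that], of "\<bar>x - \<xi>\<bar>"] by (simp add: mult.commute)
  qed
  then show ?thesis using that[of "norm (G x0)"] G(2)[OF x0(1)] by simp
qed

text \<open>The common factor \<open>x - \<xi>\<close> of numerator and denominator cancels, and the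
  remaining denominator has no zeros.\<close>

lemma smooth_quotient_g:
  assumes "smooth_on h {a..b}" "h \<xi> = 0"
  obtains R where "smooth_on R {a..b}" "\<And>x. x \<in> {a..b} - {\<xi>} \<Longrightarrow> R x = h x / complex_of_real (g x)"
proof -
  obtain G where G: "smooth_on G {a..b}" "\<And>x. x \<in> {a..b} \<Longrightarrow> G x \<noteq> 0"
    "\<And>x. x \<in> {a..b} \<Longrightarrow> complex_of_real (g x) = of_real (x - \<xi>) * G x"
    using g_factor by blast
  obtain H where H: "smooth_on H {a..b}" "\<And>x. x \<in> {a..b} \<Longrightarrow> h x = of_real (x - \<xi>) * H x"
    using smooth_on_factor_zero[OF ab \<xi> assms] by metis
  show ?thesis
  proof (rule that[of "\<lambda>x. H x / G x"])
    show "smooth_on (\<lambda>x. H x / G x) {a..b}" by (intro smooth_on_divide H G)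
    fix x assume x: "x \<in> {a..b} - {\<xi>}"
    then have "complex_of_real (x - \<xi>) \<noteq> 0" by simp
    then show "H x / G x = h x / complex_of_real (g x)"
      using x by (simp add: G H del: of_real_diff)
  qed
qed

text \<open>The powers \<open>g\<^sup>\<mu>\<close> and \<open>g\<^sup>-\<^sup>\<mu>\<close> cancel after differentiation, which
  leaves \<open>(h / g')' - \<mu> h / g\<close> with \<open>h = s - s(\<xi>)\<close>; this is smooth across \<open>\<xi>\<close> because \<open>h(\<xi>) = 0\<close>.\<close>

lemma sigmaT_Suc_smooth:
  fixes \<nu> :: complex and f :: "real \<Rightarrow> real" and k :: nat
  defines "s \<equiv> sigmaT \<nu> f g a b \<xi> k"
  assumes s: "smooth_on s {a..b}"
    and q': "\<And>x. x \<in> {a..b} \<Longrightarrow> ((\<lambda>x. (s x - s \<xi>) / g' x) has_vector_derivative q' x) (at x within {a..b})"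
    and smooth_q': "smooth_on q' {a..b}"
  shows "smooth_on (sigmaT \<nu> f g a b \<xi> (Suc k)) {a..b}"
    and "x \<in> {a..b} - {\<xi>} \<Longrightarrow> sigmaT \<nu> f g a b \<xi> (Suc k) x
      = q' x - (\<nu> + of_nat (Suc k)) * ((s x - s \<xi>) / of_real (g x))"
proof -
  define \<mu> where "\<mu> = \<nu> + of_nat (Suc k)"
  define r where "r = (\<lambda>x. (complex_of_real (g x)) powr \<mu> *
                 vector_derivative
                   (\<lambda>y. (s y - s \<xi>) / ((complex_of_real (g y)) powr \<mu> * g' y)) (at x within {a..b}))"
  have sT: "sigmaT \<nu> f g a b \<xi> (Suc k) =
      (\<lambda>x. if x = \<xi> then Lim (at \<xi> within ({a..b} - {\<xi>})) r else r x)"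
    unfolding r_def s_def \<mu>_def Let_def sigmaT.simps ..
  have r: "r x = q' x - \<mu> * ((s x - s \<xi>) / of_real (g x))" if x: "x \<in> {a..b} - {\<xi>}" for x
  proof -
    let ?p = "complex_of_real (g x) powr \<mu>"
    have gx: "g x \<noteq> 0" using x g_nz by auto
    have xI: "x \<in> {a..b}" using x by simp
    have p: "((\<lambda>y. complex_of_real (g y) powr (- \<mu>)) has_vector_derivative
        dI g a b x *\<^sub>R (- \<mu> * complex_of_real (g x) powr (- \<mu>) / of_real (g x))) (at x within {a..b})"
      using vector_diff_chain_within[OF g_deriv[OF xI]
          has_vector_derivative_at_within[OF has_vector_derivative_of_real_powr[OF gx, of "- \<mu>"]]]
      by (simp add: o_def)
    have "(\<lambda>y. (s y - s \<xi>) / ((complex_of_real (g y)) powr \<mu> * g' y))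
       = (\<lambda>y. (s y - s \<xi>) / g' y * complex_of_real (g y) powr (- \<mu>))"
      by (simp add: powr_minus divide_inverse mult_ac)
    then have "((\<lambda>y. (s y - s \<xi>) / ((complex_of_real (g y)) powr \<mu> * g' y)) has_vector_derivative
       (s x - s \<xi>) / g' x * (dI g a b x *\<^sub>R (- \<mu> * complex_of_real (g x) powr (- \<mu>) / of_real (g x)))
        + q' x * complex_of_real (g x) powr (- \<mu>)) (at x within {a..b})"
      using has_vector_derivative_mult[OF q'[OF xI] p] by simp
    from vector_derivative_within_closed_interval[OF ab xI this]
    have rx: "r x = ?p * ((s x - s \<xi>) / g' x * (dI g a b x *\<^sub>R (- \<mu> * complex_of_real (g x) powr (- \<mu>) / of_real (g x)))
        + q' x * complex_of_real (g x) powr (- \<mu>))"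
      unfolding r_def by (simp only:)
    have minus: "complex_of_real (g x) powr (- \<mu>) = inverse ?p" by (simp add: powr_minus)
    \<comment> \<open>The power and the derivative of \<open>g\<close> are abstracted to nonzero
      complex numbers, which turns their cancellation into field arithmetic.\<close>
    have alg: "p * (h / d * (d * (- m * inverse p / G)) + q * inverse p) = q - m * (h / G)"
      if "p \<noteq> 0" "d \<noteq> 0" "G \<noteq> 0" for p h d m G q :: complex
      using that by (simp add: field_simps)
    show ?thesis
      unfolding rx scaleR_conv_of_real minus by (rule alg) (use g'_nz[OF xI] gx in auto)
  qed
  have "smooth_on (\<lambda>x. s x - s \<xi>) {a..b}" by (intro smooth_on_diff s smooth_on_const)
  from smooth_quotient_g[OF this diff_self] obtain H where H: "smooth_on H {a..b}"
     "\<And>x. x \<in> {a..b} - {\<xi>} \<Longrightarrow> H x = (s x - s \<xi>) / complex_of_real (g x)"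
    by blast
  define R where "R = (\<lambda>x. q' x - \<mu> * H x)"
  have smooth_R: "smooth_on R {a..b}"
    unfolding R_def by (intro smooth_on_diff smooth_on_mult smooth_on_const H smooth_q')
  have "(R \<longlongrightarrow> R \<xi>) (at \<xi> within {a..b} - {\<xi>})"
    using smooth_on_imp_continuous_on[OF smooth_R] \<xi> unfolding continuous_on_def
    by (meson Diff_subset tendsto_within_subset)
  moreover have "eventually (\<lambda>x. R x = r x) (at \<xi> within {a..b} - {\<xi>})"
    unfolding eventually_at_filter using r H by (auto simp: R_def)
  ultimately have "(r \<longlongrightarrow> R \<xi>) (at \<xi> within {a..b} - {\<xi>})"
    by (rule Lim_transform_eventually)
  \<comment> \<open>Even as an endpoint, \<xi> is a limit point of the punctured interval since
    \<open>a < b\<close>. Hence \<open>Lim\<close> in \<open>sigmaT\<close> is the genuine limit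
    \<open>R \<xi>\<close>.\<close>
  moreover have "\<not> trivial_limit (at \<xi> within {a..b} - {\<xi>})"
    using ab \<xi> islimpt_Icc[OF ab, of \<xi>] islimpt_punctured[of \<xi> "{a..b}"] by (simp add: trivial_limit_within)
  ultimately have "Lim (at \<xi> within ({a..b} - {\<xi>})) r = R \<xi>"
    by (intro tendsto_Lim)
  then have "R x = sigmaT \<nu> f g a b \<xi> (Suc k) x" if "x \<in> {a..b}" for x
    unfolding sT using r H that by (auto simp: R_def)
  then show "smooth_on (sigmaT \<nu> f g a b \<xi> (Suc k)) {a..b}"
    using smooth_R smooth_on_cong by blast
  show "x \<in> {a..b} - {\<xi>} \<Longrightarrow> sigmaT \<nu> f g a b \<xi> (Suc k) x
      = q' x - (\<nu> + of_nat (Suc k)) * ((s x - s \<xi>) / of_real (g x))"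
    unfolding sT using r by (auto simp: \<mu>_def)
qed

text \<open>The constant \<open>c\<close> stays free: it is \<open>s \<xi>\<close> for the
  integration by parts and 0 when the reciprocal of the derivative of \<open>g\<close> is
  differentiated.\<close>

lemma smooth_quotient_derivative:
  assumes "smooth_on s {a..b}"
  obtains q' where "smooth_on q' {a..b}"
    "\<And>x. x \<in> {a..b} \<Longrightarrow> ((\<lambda>x. (s x - c) / g' x) has_vector_derivative q' x) (at x within {a..b})"
proof -
  have "smooth_on (\<lambda>x. (s x - c) / g' x) {a..b}"
    by (intro smooth_on_divide smooth_on_diff smooth_on_const assms smooth_g') (use g'_nz in auto)
  from smooth_on_Icc_derivative[OF ab this] that show ?thesis by blast
qed

lemma sigmaT_smooth:
  assumes "smooth_on_interval f {a..b}"
  shows "smooth_on (sigmaT \<nu> f g a b \<xi> k) {a..b}"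
proof (induction k)
  case 0
  show ?case using smooth_on_interval_derivative(1)[OF ab assms] by simp
next
  case (Suc k)
  obtain q' where "smooth_on q' {a..b}"
    "\<And>x. x \<in> {a..b} \<Longrightarrow> ((\<lambda>x. (sigmaT \<nu> f g a b \<xi> k x - sigmaT \<nu> f g a b \<xi> k \<xi>) / g' x)
       has_vector_derivative q' x) (at x within {a..b})"
    using smooth_quotient_derivative[OF Suc] by blast
  then show ?case by (intro sigmaT_Suc_smooth(1)[OF Suc])
qed

section \<open>Calculus along the phase: integration by parts and integrability\<close>

lemma has_vector_derivative_at_interior:
  "(F has_vector_derivative D) (at x within {a..b}) \<Longrightarrow> x \<in> {a<..<b} \<Longrightarrow> (F has_vector_derivative D) (at x)"
  by (simp add: at_within_Icc_at)

lemma continuous_on_bessel_phase: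
  "Re \<mu> > 0 \<Longrightarrow> continuous_on {a..b} (\<lambda>x. bessel_J \<mu> (of_real (\<omega> * g x)))"
  by (rule continuous_on_compose2[OF continuous_bessel_J]) (auto intro!: continuous_intros continuous_on_g)

lemma has_vector_derivative_phase:
  assumes "(F has_vector_derivative D) (at (\<omega> * g x))" "x \<in> {a..b}"
  shows "((\<lambda>x. F (\<omega> * g x)) has_vector_derivative of_real \<omega> * g' x * D) (at x within {a..b})"
proof -
  have "((\<lambda>x. \<omega> * g x) has_vector_derivative \<omega> * dI g a b x) (at x within {a..b})"
    using g_deriv[OF assms(2)] by (rule has_vector_derivative_mult_right)
  from vector_diff_chain_within[OF this has_vector_derivative_at_within[OF assms(1)]]
  show ?thesis by (simp add: o_def scaleR_conv_of_real)
qed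

text \<open>The 1/g term from differentiating the Bessel factor combines with q' into \<sigma>. The
  fundamental theorem tolerates the exceptional point \<xi>, where the antiderivative is continuous
  because the order \<mu> + 1 has positive real part.\<close>

lemma integral_by_parts_bessel:
  fixes s \<sigma> q' :: "real \<Rightarrow> complex"
  assumes \<mu>: "Re \<mu> > -1" and \<omega>: "\<omega> > 0"
    and s: "continuous_on {a..b} s"
    and q': "\<And>x. x \<in> {a..b} \<Longrightarrow> ((\<lambda>x. (s x - s \<xi>) / g' x) has_vector_derivative q' x) (at x within {a..b})"
    and \<sigma>: "\<And>x. x \<in> {a..b} - {\<xi>} \<Longrightarrow> \<sigma> x = q' x - (\<mu> + 1) * ((s x - s \<xi>) / of_real (g x))"
  shows "((\<lambda>x. \<sigma> x * bessel_J (\<mu> + 1) (of_real (\<omega> * g x))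
           + of_real \<omega> * ((s x - s \<xi>) * bessel_J \<mu> (of_real (\<omega> * g x)))) has_integral
         ((s b - s \<xi>) / g' b * bessel_J (\<mu> + 1) (of_real (\<omega> * g b))
           - (s a - s \<xi>) / g' a * bessel_J (\<mu> + 1) (of_real (\<omega> * g a)))) {a..b}"
proof (rule fundamental_theorem_of_calculus_interior_strong[of "{\<xi>}"])
  show "continuous_on {a..b} (\<lambda>x. (s x - s \<xi>) / g' x * bessel_J (\<mu> + 1) (of_real (\<omega> * g x)))"
    by (intro continuous_intros s smooth_on_imp_continuous_on[OF smooth_g'] continuous_on_bessel_phase)
       (use \<mu> g'_nz in auto)
next
  fix x assume x: "x \<in> {a<..<b} - {\<xi>}"
  then have xI: "x \<in> {a..b}" and gx: "g x \<noteq> 0" using g_nz by auto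
  then have t: "\<omega> * g x \<noteq> 0" using \<omega> by simp
  let ?J = "bessel_J \<mu> (of_real (\<omega> * g x))" and ?J1 = "bessel_J (\<mu> + 1) (of_real (\<omega> * g x))"
  have "((\<lambda>x. (s x - s \<xi>) / g' x * bessel_J (\<mu> + 1) (of_real (\<omega> * g x))) has_vector_derivative
      (s x - s \<xi>) / g' x * (of_real \<omega> * g' x * (?J - (\<mu> + 1) / of_real (\<omega> * g x) * ?J1))
       + q' x * ?J1) (at x within {a..b})"
    by (intro has_vector_derivative_mult q' xI has_vector_derivative_phase has_vector_derivative_bessel_J' t)
  moreover have "(s x - s \<xi>) / g' x * (of_real \<omega> * g' x * (?J - (\<mu> + 1) / of_real (\<omega> * g x) * ?J1))
       + q' x * ?J1 = \<sigma> x * ?J1 + of_real \<omega> * ((s x - s \<xi>) * ?J)"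
  proof -
    have alg: "h / p * (w * p * (J - m / (w * G) * J1)) = h * (w * J) - m * (h / G) * J1"
      if "p \<noteq> 0" "w \<noteq> 0" "G \<noteq> 0" for h p w J m G J1 :: complex
      using that by (simp add: field_simps)
    have "\<sigma> x = q' x - (\<mu> + 1) * ((s x - s \<xi>) / of_real (g x))" using \<sigma> x by auto
    moreover have "(s x - s \<xi>) / g' x * (of_real \<omega> * g' x * (?J - (\<mu> + 1) / of_real (\<omega> * g x) * ?J1))
       = (s x - s \<xi>) * (of_real \<omega> * ?J) - (\<mu> + 1) * ((s x - s \<xi>) / of_real (g x)) * ?J1"
      unfolding of_real_mult by (rule alg) (use gx \<omega> g'_nz[OF xI] in auto)
    ultimately show ?thesis by (simp only:) (simp add: algebra_simps)
  qed
  ultimately show "((\<lambda>x. (s x - s \<xi>) / g' x * bessel_J (\<mu> + 1) (of_real (\<omega> * g x))) has_vector_derivative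
      \<sigma> x * ?J1 + of_real \<omega> * ((s x - s \<xi>) * ?J)) (at x)"
    using has_vector_derivative_at_interior x by auto
qed (use ab in auto)

text \<open>For \<open>-1 < Re \<mu> \<le> 0\<close> the integrand is unbounded at \<open>\<xi>\<close>. Since
  \<open>(t J\<^sub>\<mu>(t))' = (\<mu> + 1) J\<^sub>\<mu>(t) - t J\<^bsub>\<mu>+1\<^esub>(t)\<close>, it is, up to a continuous function,
  the derivative of a continuous one.\<close>

lemma integrable_bessel_phase:
  assumes \<mu>: "Re \<mu> > -1" and \<omega>: "\<omega> > 0"
  shows "(\<lambda>x. bessel_J \<mu> (of_real (\<omega> * g x))) integrable_on {a..b}"
proof -
  define \<Psi> where "\<Psi> = (\<lambda>t. of_real t * bessel_J \<mu> (of_real t))"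
  \<comment> \<open>The recurrence rewrites t J_mu(t) through orders with positive real part, hence
    as a continuous function. At t = 0 both sides vanish by the default value of
    \<open>bessel_J\<close>.\<close>
  have \<Psi>_eq: "\<Psi> t = 2 * (\<mu> + 1) * bessel_J (\<mu> + 1) (of_real t) - of_real t * bessel_J (\<mu> + 2) (of_real t)" for t
  proof (cases "t = 0")
    case True
    have "\<mu> + 1 \<noteq> 0" using \<mu> by (auto simp: complex_eq_iff)
    with True show ?thesis by (simp add: \<Psi>_def bessel_J_def)
  next
    case False
    then have "2 * (\<mu> + 1) * bessel_J (\<mu> + 1) (of_real t)
      = of_real t * (bessel_J \<mu> (of_real t) + bessel_J (\<mu> + 2) (of_real t))"
      using bessel_J_recurrence[OF False, of \<mu>] by simp
    then show ?thesis by (simp add: \<Psi>_def algebra_simps)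
  qed
  have cont: "continuous_on {a..b} (\<lambda>x. \<Psi> (\<omega> * g x))"
    unfolding \<Psi>_eq by (intro continuous_intros continuous_on_bessel_phase continuous_on_g) (use \<mu> in auto)
  have d\<Psi>: "(\<Psi> has_vector_derivative (\<mu> + 1) * bessel_J \<mu> (of_real t) - of_real t * bessel_J (\<mu> + 1) (of_real t)) (at t)"
    if "t \<noteq> 0" for t
  proof -
    have "(complex_of_real has_vector_derivative of_real 1) (at t)"
      by (intro has_vector_derivative_of_real) (rule DERIV_ident)
    from has_vector_derivative_mult[OF this has_vector_derivative_bessel_J[OF that, of \<mu>]] that
    show ?thesis unfolding \<Psi>_def by (simp add: algebra_simps)
  qed
  obtain q' where q': "smooth_on q' {a..b}"
    "\<And>x. x \<in> {a..b} \<Longrightarrow> ((\<lambda>x. (1 - 0) / g' x) has_vector_derivative q' x) (at x within {a..b})"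
    using smooth_quotient_derivative[OF smooth_on_const[of 1], of 0] by metis
  define Q where "Q = (\<lambda>x. (1 - 0) / g' x * \<Psi> (\<omega> * g x))"
  define E where "E = (\<lambda>x. q' x * \<Psi> (\<omega> * g x)
     - of_real \<omega> * (of_real (\<omega> * g x) * bessel_J (\<mu> + 1) (of_real (\<omega> * g x))))"
  have "((\<lambda>x. of_real \<omega> * (\<mu> + 1) * bessel_J \<mu> (of_real (\<omega> * g x)) + E x) has_integral (Q b - Q a)) {a..b}"
  proof (rule fundamental_theorem_of_calculus_interior_strong[of "{\<xi>}"])
    show "continuous_on {a..b} Q"
      unfolding Q_def by (intro continuous_intros cont smooth_on_imp_continuous_on[OF smooth_g'])
        (use g'_nz in auto)
  next
    fix x assume x: "x \<in> {a<..<b} - {\<xi>}"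
    then have xI: "x \<in> {a..b}" and gx: "g x \<noteq> 0" using g_nz by auto
    then have t: "\<omega> * g x \<noteq> 0" using \<omega> by simp
    have "(Q has_vector_derivative (1 - 0) / g' x * (of_real \<omega> * g' x *
        ((\<mu> + 1) * bessel_J \<mu> (of_real (\<omega> * g x)) - of_real (\<omega> * g x) * bessel_J (\<mu> + 1) (of_real (\<omega> * g x))))
       + q' x * \<Psi> (\<omega> * g x)) (at x within {a..b})"
      unfolding Q_def by (intro has_vector_derivative_mult q' xI has_vector_derivative_phase d\<Psi> t)
    moreover have "(1 - 0) / g' x * (of_real \<omega> * g' x *
        ((\<mu> + 1) * bessel_J \<mu> (of_real (\<omega> * g x)) - of_real (\<omega> * g x) * bessel_J (\<mu> + 1) (of_real (\<omega> * g x))))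
       + q' x * \<Psi> (\<omega> * g x) = of_real \<omega> * (\<mu> + 1) * bessel_J \<mu> (of_real (\<omega> * g x)) + E x"
      using g'_nz[OF xI] unfolding E_def by (simp add: algebra_simps)
    ultimately show "(Q has_vector_derivative of_real \<omega> * (\<mu> + 1) * bessel_J \<mu> (of_real (\<omega> * g x)) + E x) (at x)"
      using has_vector_derivative_at_interior x by auto
  qed (use ab in auto)
  then have 1: "(\<lambda>x. of_real \<omega> * (\<mu> + 1) * bessel_J \<mu> (of_real (\<omega> * g x)) + E x) integrable_on {a..b}"
    by blast
  have "continuous_on {a..b} E"
    unfolding E_def by (intro continuous_intros cont smooth_on_imp_continuous_on[OF q'(1)]
       continuous_on_bessel_phase continuous_on_g) (use \<mu> in auto)
  then have "E integrable_on {a..b}" by (rule integrable_continuous_real)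
  from integrable_diff[OF 1 this]
  have "(\<lambda>x. of_real \<omega> * (\<mu> + 1) * bessel_J \<mu> (of_real (\<omega> * g x))) integrable_on {a..b}" by simp
  from integrable_on_mult_right[OF this, of "inverse (of_real \<omega> * (\<mu> + 1))"]
  have "(\<lambda>x. inverse (of_real \<omega> * (\<mu> + 1)) * (of_real \<omega> * (\<mu> + 1)) * bessel_J \<mu> (of_real (\<omega> * g x))) integrable_on {a..b}"
    by (simp only: mult.assoc)
  \<comment> \<open>The division is legitimate: Re \<mu> > -1 excludes \<mu> = -1.\<close>
  moreover have "inverse (of_real \<omega> * (\<mu> + 1)) * (of_real \<omega> * (\<mu> + 1)) = 1"
    using \<omega> \<mu> by (intro left_inverse) (auto simp: complex_eq_iff)
  ultimately show ?thesis by (simp only: mult_1_left)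
qed

section \<open>Estimates for the remainder\<close>

lemma integrable_inverse_sqrt: "(\<lambda>x. 1 / sqrt \<bar>x - \<xi>\<bar>) integrable_on {a..b}"
proof -
  \<comment> \<open>The library's \<open>sqrt\<close> is an odd function, so
    \<open>2 * sqrt (x - \<xi>)\<close> is an antiderivative on both sides of \<xi> and continuous
    across it.\<close>
  have "((\<lambda>x. 1 / sqrt \<bar>x - \<xi>\<bar>) has_integral (2 * sqrt (b - \<xi>) - 2 * sqrt (a - \<xi>))) {a..b}"
  proof (rule fundamental_theorem_of_calculus_interior_strong[of "{\<xi>}"])
    fix x assume "x \<in> {a<..<b} - {\<xi>}"
    then have x: "x - \<xi> \<noteq> 0" by simp
    have "(sqrt has_real_derivative 1 / (2 * sqrt \<bar>x - \<xi>\<bar>)) (at (x - \<xi>))"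
      by (rule DERIV_real_sqrt_generic[OF x]) (use real_sqrt_minus[of "\<xi> - x"] in \<open>simp_all add: abs_if divide_simps\<close>)
    moreover have "((\<lambda>x. x - \<xi>) has_real_derivative 1) (at x)"
      by (auto intro!: derivative_eq_intros)
    ultimately have "((\<lambda>x. sqrt (x - \<xi>)) has_real_derivative 1 / (2 * sqrt \<bar>x - \<xi>\<bar>) * 1) (at x)"
      by (rule DERIV_chain2[where f = sqrt and g = "\<lambda>x. x - \<xi>"])
    from DERIV_cmult[OF this, of 2]
    have "((\<lambda>x. 2 * sqrt (x - \<xi>)) has_real_derivative 1 / sqrt \<bar>x - \<xi>\<bar>) (at x)"
      by simp
    then show "((\<lambda>x. 2 * sqrt (x - \<xi>)) has_vector_derivative 1 / sqrt \<bar>x - \<xi>\<bar>) (at x)"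
      by (simp add: has_real_derivative_iff_has_vector_derivative)
  qed (use ab in \<open>auto intro!: continuous_intros\<close>)
  then show ?thesis by blast
qed

lemma integral_bessel_bound:
  assumes \<mu>: "Re \<mu> > 0" and \<sigma>: "continuous_on {a..b} \<sigma>"
  obtains C where "\<And>\<omega>. \<omega> > 0 \<Longrightarrow>
    norm (integral {a..b} (\<lambda>x. \<sigma> x * bessel_J \<mu> (of_real (\<omega> * g x)))) \<le> C / sqrt \<omega>"
proof -
  obtain K where K: "K \<ge> 0" "\<And>t. t \<noteq> 0 \<Longrightarrow> norm (bessel_J \<mu> (of_real t)) \<le> K / sqrt \<bar>t\<bar>"
    using bessel_J_bound[OF \<mu>] by blast
  obtain c where c: "c > 0" "\<And>x. x \<in> {a..b} \<Longrightarrow> c * \<bar>x - \<xi>\<bar> \<le> \<bar>g x\<bar>"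
    using g_lower_bound by blast
  have "bounded (\<sigma> ` {a..b})" by (intro compact_imp_bounded compact_continuous_image \<sigma>) auto
  then obtain M where M: "M \<ge> 0" "\<And>x. x \<in> {a..b} \<Longrightarrow> norm (\<sigma> x) \<le> M"
    unfolding bounded_pos by (metis imageI less_imp_le)
  \<comment> \<open>Collects the bound on \<sigma>, the Bessel constant and the slope in the lower
    bound for |g|.\<close>
  define D where "D = M * K / sqrt c"
  show ?thesis
  proof (rule that)
    fix \<omega> :: real assume \<omega>: "\<omega> > 0"
    have "norm (integral {a..b} (\<lambda>x. \<sigma> x * bessel_J \<mu> (of_real (\<omega> * g x))))
       \<le> integral {a..b} (\<lambda>x. D / sqrt \<omega> * (1 / sqrt \<bar>x - \<xi>\<bar>))"
    proof (rule integral_norm_bound_integral)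
      show "(\<lambda>x. \<sigma> x * bessel_J \<mu> (of_real (\<omega> * g x))) integrable_on {a..b}"
        by (intro integrable_continuous_real continuous_intros \<sigma> continuous_on_bessel_phase \<mu>)
      show "(\<lambda>x. D / sqrt \<omega> * (1 / sqrt \<bar>x - \<xi>\<bar>)) integrable_on {a..b}"
        by (intro integrable_on_mult_right integrable_inverse_sqrt)
      fix x assume x: "x \<in> {a..b}"
      show "norm (\<sigma> x * bessel_J \<mu> (of_real (\<omega> * g x))) \<le> D / sqrt \<omega> * (1 / sqrt \<bar>x - \<xi>\<bar>)"
      proof (cases "x = \<xi>")
        \<comment> \<open>Both sides are 0 here: the Bessel factor by its default value at 0, the
          right-hand side because division by zero yields 0.\<close>
        case True
        then show ?thesis using \<mu> by (auto simp: g_zero bessel_J_def)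
      next
        case False
        have "norm (bessel_J \<mu> (of_real (\<omega> * g x))) \<le> K / sqrt \<bar>\<omega> * g x\<bar>"
          using K(2)[of "\<omega> * g x"] g_nz[OF x False] \<omega> by simp
        also have "\<dots> \<le> K / sqrt (\<omega> * (c * \<bar>x - \<xi>\<bar>))"
          using c(2)[OF x] \<omega> c(1) False K(1) g_nz[OF x False]
          by (intro divide_left_mono) (auto simp: abs_mult intro!: mult_pos_pos)
        finally have "norm (\<sigma> x) * norm (bessel_J \<mu> (of_real (\<omega> * g x))) \<le> M * (K / sqrt (\<omega> * (c * \<bar>x - \<xi>\<bar>)))"
          using M x by (intro mult_mono) auto
        then show ?thesis by (simp add: norm_mult D_def real_sqrt_mult mult_ac)
      qed
    qed
    also have "\<dots> = (D * integral {a..b} (\<lambda>x. 1 / sqrt \<bar>x - \<xi>\<bar>)) / sqrt \<omega>"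
      by (subst integral_mult_right) simp
    finally show "norm (integral {a..b} (\<lambda>x. \<sigma> x * bessel_J \<mu> (of_real (\<omega> * g x))))
       \<le> (D * integral {a..b} (\<lambda>x. 1 / sqrt \<bar>x - \<xi>\<bar>)) / sqrt \<omega>" .
  qed
qed

text \<open>If the endpoint is \<xi>, the coefficient vanishes; otherwise \<open>g x\<close> is a
  fixed nonzero number and the Bessel bound applies.\<close>

lemma boundary_bessel_bound:
  fixes s :: "real \<Rightarrow> complex"
  assumes \<mu>: "Re \<mu> > 0" and x: "x \<in> {a..b}"
  obtains C where "\<And>\<omega>. \<omega> > 0 \<Longrightarrow> norm ((s x - s \<xi>) / g' x * bessel_J \<mu> (of_real (\<omega> * g x))) \<le> C / sqrt \<omega>"
proof (cases "x = \<xi>")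
  case True
  then show ?thesis using that[of 0] by simp
next
  case False
  obtain K where K: "K \<ge> 0" "\<And>t. t \<noteq> 0 \<Longrightarrow> norm (bessel_J \<mu> (of_real t)) \<le> K / sqrt \<bar>t\<bar>"
    using bessel_J_bound[OF \<mu>] by blast
  let ?q = "norm ((s x - s \<xi>) / g' x)"
  show ?thesis
  proof (rule that)
    fix \<omega> :: real assume \<omega>: "\<omega> > 0"
    have "?q * norm (bessel_J \<mu> (of_real (\<omega> * g x))) \<le> ?q * (K / sqrt \<bar>\<omega> * g x\<bar>)"
      using g_nz[OF x False] \<omega> by (intro mult_left_mono K) auto
    also have "\<dots> = (?q * K / sqrt \<bar>g x\<bar>) / sqrt \<omega>"
      using \<omega> by (simp add: abs_mult real_sqrt_mult)
    finally show "norm ((s x - s \<xi>) / g' x * bessel_J \<mu> (of_real (\<omega> * g x))) \<le> (?q * K / sqrt \<bar>g x\<bar>) / sqrt \<omega>"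
      by (simp only: norm_mult)
  qed
qed

end

section \<open>Expansion and remainder\<close>

context bessel_phase
begin

text \<open>The index is shifted: \<open>bdry \<nu> f k\<close> is the bracket of the summand k + 1
  of the boundary series, without its power of \<omega>.\<close>

definition bdry :: "complex \<Rightarrow> (real \<Rightarrow> real) \<Rightarrow> nat \<Rightarrow> real \<Rightarrow> complex" where
  "bdry \<nu> f k \<omega> =
     (sigmaT \<nu> f g a b \<xi> k b - sigmaT \<nu> f g a b \<xi> k \<xi>) / g' b
       * bessel_J (\<nu> + of_nat (Suc k)) (of_real (\<omega> * g b))
   - (sigmaT \<nu> f g a b \<xi> k a - sigmaT \<nu> f g a b \<xi> k \<xi>) / g' a
       * bessel_J (\<nu> + of_nat (Suc k)) (of_real (\<omega> * g a))"

definition sigma_integral :: "complex \<Rightarrow> (real \<Rightarrow> real) \<Rightarrow> nat \<Rightarrow> real \<Rightarrow> complex" where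
  "sigma_integral \<nu> f k \<omega> =
     integral {a..b} (\<lambda>x. sigmaT \<nu> f g a b \<xi> k x * bessel_J (\<nu> + of_nat k) (of_real (\<omega> * g x)))"

text \<open>Subtracting the value at \<xi> splits off the moment; the rest vanishes at \<xi>, so an
  integration by parts gains 1/\<omega> and raises the order by one.\<close>

lemma sigma_integral_step:
  assumes \<nu>: "Re \<nu> > -1" and \<omega>: "\<omega> > 0" and f: "smooth_on_interval f {a..b}"
  shows "sigma_integral \<nu> f k \<omega> - sigmaT \<nu> f g a b \<xi> k \<xi> * Mnu (\<nu> + of_nat k) g a b \<omega>
     = (bdry \<nu> f k \<omega> - sigma_integral \<nu> f (Suc k) \<omega>) / of_real \<omega>"
proof -
  define s where "s = sigmaT \<nu> f g a b \<xi> k"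
  define \<sigma> where "\<sigma> = sigmaT \<nu> f g a b \<xi> (Suc k)"
  define \<mu> where "\<mu> = \<nu> + of_nat k"
  have \<mu>1: "\<nu> + of_nat (Suc k) = \<mu> + 1" by (simp add: \<mu>_def)
  have \<mu>: "Re \<mu> > -1" using \<nu> by (simp add: \<mu>_def)
  let ?J = "\<lambda>x. bessel_J \<mu> (of_real (\<omega> * g x))" and ?J1 = "\<lambda>x. bessel_J (\<mu> + 1) (of_real (\<omega> * g x))"
  have smooth_s: "smooth_on s {a..b}" and smooth_\<sigma>: "smooth_on \<sigma> {a..b}"
    unfolding s_def \<sigma>_def by (intro sigmaT_smooth f)+
  obtain q' where q': "smooth_on q' {a..b}"
    "\<And>x. x \<in> {a..b} \<Longrightarrow> ((\<lambda>x. (s x - s \<xi>) / g' x) has_vector_derivative q' x) (at x within {a..b})"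
    using smooth_quotient_derivative[OF smooth_s] by blast
  \<comment> \<open>The same q' enters this formula and the integration by parts, which makes the
    two fit together.\<close>
  have \<sigma>: "\<sigma> x = q' x - (\<mu> + 1) * ((s x - s \<xi>) / of_real (g x))" if "x \<in> {a..b} - {\<xi>}" for x
    using sigmaT_Suc_smooth(2)[OF smooth_s[unfolded s_def] q'(2)[unfolded s_def] q'(1) that]
    by (simp only: s_def \<sigma>_def \<mu>1)
  have parts: "((\<lambda>x. \<sigma> x * ?J1 x + of_real \<omega> * ((s x - s \<xi>) * ?J x)) has_integral bdry \<nu> f k \<omega>) {a..b}"
    using integral_by_parts_bessel[OF \<mu> \<omega> smooth_on_imp_continuous_on[OF smooth_s] q'(2) \<sigma>]
    unfolding bdry_def \<mu>1 s_def[symmetric] .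
  have "(\<lambda>x. \<sigma> x * ?J1 x) integrable_on {a..b}"
    by (intro integrable_continuous_real continuous_intros smooth_on_imp_continuous_on[OF smooth_\<sigma>]
        continuous_on_bessel_phase) (use \<mu> in simp)
  then have i\<sigma>: "((\<lambda>x. \<sigma> x * ?J1 x) has_integral sigma_integral \<nu> f (Suc k) \<omega>) {a..b}"
    unfolding sigma_integral_def \<mu>1 \<sigma>_def[symmetric] by (rule integrable_integral)
  \<comment> \<open>Removing the integrable \<sigma> term from the combined integral isolates the
    other one, whose integrability comes out of the fundamental theorem.\<close>
  have "((\<lambda>x. of_real (1 / \<omega>) * ((\<sigma> x * ?J1 x + of_real \<omega> * ((s x - s \<xi>) * ?J x)) - \<sigma> x * ?J1 x)) has_integral
     of_real (1 / \<omega>) * (bdry \<nu> f k \<omega> - sigma_integral \<nu> f (Suc k) \<omega>)) {a..b}"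
    by (intro has_integral_mult_right has_integral_diff parts i\<sigma>)
  then have iT: "((\<lambda>x. (s x - s \<xi>) * ?J x) has_integral
     (bdry \<nu> f k \<omega> - sigma_integral \<nu> f (Suc k) \<omega>) / of_real \<omega>) {a..b}"
    using \<omega> by simp
  have iM: "((\<lambda>x. s \<xi> * ?J x) has_integral s \<xi> * Mnu \<mu> g a b \<omega>) {a..b}"
    unfolding Mnu_def by (intro has_integral_mult_right integrable_integral integrable_bessel_phase \<mu> \<omega>)
  have "((\<lambda>x. s x * ?J x) has_integral
     (bdry \<nu> f k \<omega> - sigma_integral \<nu> f (Suc k) \<omega>) / of_real \<omega> + s \<xi> * Mnu \<mu> g a b \<omega>) {a..b}"
    using has_integral_add[OF iT iM] by (simp add: left_diff_distrib)
  from integral_unique[OF this] show ?thesis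
    unfolding sigma_integral_def[of _ _ k] s_def[symmetric] \<mu>_def[symmetric] by simp
qed

text \<open>The one-step identity divided by (-\<omega>)^k telescopes. The boundary sum ends with
  \<open>bdry\<close> at N - 1, so \<open>bdry\<close> at N stays in the remainder.\<close>

lemma remainder_formula:
  assumes \<nu>: "Re \<nu> > -1" and \<omega>: "\<omega> > 0" and f: "smooth_on_interval f {a..b}"
  shows "Hnu \<nu> f g a b \<omega>
      - ((\<Sum>k\<le>N. sigmaT \<nu> f g a b \<xi> k \<xi> / (- complex_of_real \<omega>) ^ k * Mnu (\<nu> + of_nat k) g a b \<omega>)
         - (\<Sum>k\<in>{1..N}. 1 / (- complex_of_real \<omega>) ^ k * bdry \<nu> f (k - 1) \<omega>))
    = (sigma_integral \<nu> f (Suc N) \<omega> - bdry \<nu> f N \<omega>) / (- complex_of_real \<omega>) ^ Suc N"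
proof -
  let ?w = "- complex_of_real \<omega>"
  have w: "?w \<noteq> 0" using \<omega> by simp
  have step: "sigma_integral \<nu> f k \<omega> / ?w ^ k
    = sigmaT \<nu> f g a b \<xi> k \<xi> / ?w ^ k * Mnu (\<nu> + of_nat k) g a b \<omega>
      + (sigma_integral \<nu> f (Suc k) \<omega> - bdry \<nu> f k \<omega>) / ?w ^ Suc k" for k
  proof -
    have e: "sigma_integral \<nu> f k \<omega> = sigmaT \<nu> f g a b \<xi> k \<xi> * Mnu (\<nu> + of_nat k) g a b \<omega>
       + (sigma_integral \<nu> f (Suc k) \<omega> - bdry \<nu> f k \<omega>) / ?w"
      using sigma_integral_step[OF \<nu> \<omega> f, of k] by (simp add: algebra_simps diff_divide_distrib)
    show ?thesis unfolding e by (simp add: add_divide_distrib diff_divide_distrib)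
  qed
  show ?thesis
  proof (induction N)
    case 0
    have "Hnu \<nu> f g a b \<omega> = sigma_integral \<nu> f 0 \<omega>" by (simp add: Hnu_def sigma_integral_def)
    then show ?case using step[of 0] by simp
  next
    case (Suc N)
    show ?case
      using Suc.IH step[of "Suc N"]
      by (simp add: diff_divide_distrib algebra_simps del: power_Suc sigmaT.simps)
  qed
qed

text \<open>The order \<nu> + N + 1 has positive real part even when Re \<nu> is negative, so the
  decay estimates cover the integral and both boundary terms.\<close>

lemma remainder_bound:
  assumes \<nu>: "Re \<nu> > -1" and f: "smooth_on_interval f {a..b}"
  obtains C where
    "\<And>\<omega>. \<omega> > 0 \<Longrightarrow> norm (sigma_integral \<nu> f (Suc N) \<omega> - bdry \<nu> f N \<omega>) \<le> C / sqrt \<omega>"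
proof -
  define \<mu> where "\<mu> = \<nu> + of_nat (Suc N)"
  have \<mu>: "Re \<mu> > 0" using \<nu> by (simp add: \<mu>_def)
  have ab': "a \<in> {a..b}" "b \<in> {a..b}" using ab by auto
  define s where "s = sigmaT \<nu> f g a b \<xi> N"
  obtain C1 where C1: "\<And>\<omega>. \<omega> > 0 \<Longrightarrow> norm (sigma_integral \<nu> f (Suc N) \<omega>) \<le> C1 / sqrt \<omega>"
    using integral_bessel_bound[OF \<mu> smooth_on_imp_continuous_on[OF sigmaT_smooth[OF f]]]
    unfolding sigma_integral_def \<mu>_def by blast
  obtain C2 where C2: "\<And>\<omega>. \<omega> > 0 \<Longrightarrow> norm ((s b - s \<xi>) / g' b * bessel_J \<mu> (of_real (\<omega> * g b))) \<le> C2 / sqrt \<omega>"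
    using boundary_bessel_bound[OF \<mu> ab'(2)] by blast
  obtain C3 where C3: "\<And>\<omega>. \<omega> > 0 \<Longrightarrow> norm ((s a - s \<xi>) / g' a * bessel_J \<mu> (of_real (\<omega> * g a))) \<le> C3 / sqrt \<omega>"
    using boundary_bessel_bound[OF \<mu> ab'(1)] by blast
  show ?thesis
  proof (rule that)
    fix \<omega> :: real assume \<omega>: "\<omega> > 0"
    have "norm (bdry \<nu> f N \<omega>) \<le> C2 / sqrt \<omega> + C3 / sqrt \<omega>"
      unfolding bdry_def \<mu>_def[symmetric] s_def[symmetric]
      by (rule order_trans[OF norm_triangle_ineq4 add_mono[OF C2[OF \<omega>] C3[OF \<omega>]]])
    with C1[OF \<omega>] norm_triangle_ineq4[of "sigma_integral \<nu> f (Suc N) \<omega>" "bdry \<nu> f N \<omega>"]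
    show "norm (sigma_integral \<nu> f (Suc N) \<omega> - bdry \<nu> f N \<omega>) \<le> (C1 + C2 + C3) / sqrt \<omega>"
      by (simp add: add_divide_distrib)
  qed
qed

end

text \<open>The exponent is N + 1 from as many integrations by parts plus 1/2 from the Bessel
  decay.\<close>

theorem theorem2p6:
  fixes \<nu> :: complex and a b \<xi> :: real and f g :: "real \<Rightarrow> real" and N :: nat
  assumes "Re \<nu> > -1" and "a < b"
    and "smooth_on_interval f {a..b}" and "smooth_on_interval g {a..b}"
    and "\<forall>x\<in>{a..b}. dI g a b x \<noteq> 0"
    and "\<xi> \<in> {a..b}" and "g \<xi> = 0" and "\<forall>x\<in>{a..b} - {\<xi>}. g x \<noteq> 0"
  shows "(\<lambda>\<omega>. Hnu \<nu> f g a b \<omega>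
            - ((\<Sum>k\<le>N. sigmaT \<nu> f g a b \<xi> k \<xi> / (- complex_of_real \<omega>) ^ k * Mnu (\<nu> + of_nat k) g a b \<omega>)
               - (\<Sum>k\<in>{1..N}. 1 / (- complex_of_real \<omega>) ^ k *
                    ((sigmaT \<nu> f g a b \<xi> (k - 1) b - sigmaT \<nu> f g a b \<xi> (k - 1) \<xi>) / complex_of_real (dI g a b b)
                       * bessel_J (\<nu> + of_nat k) (complex_of_real (\<omega> * g b))
                     - (sigmaT \<nu> f g a b \<xi> (k - 1) a - sigmaT \<nu> f g a b \<xi> (k - 1) \<xi>) / complex_of_real (dI g a b a)
                       * bessel_J (\<nu> + of_nat k) (complex_of_real (\<omega> * g a))))))
         \<in> O[at_top](\<lambda>\<omega>. complex_of_real (\<omega> powr (- (real N + 3 / 2))))"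
    (is "?R \<in> _")
proof -
  interpret bessel_phase a b \<xi> g
    by standard (use assms in auto)
  obtain C where C:
    "\<And>\<omega>. \<omega> > 0 \<Longrightarrow> norm (sigma_integral \<nu> f (Suc N) \<omega> - bdry \<nu> f N \<omega>) \<le> C / sqrt \<omega>"
    using remainder_bound[OF assms(1,3)] by blast
  have R: "?R \<omega> = (sigma_integral \<nu> f (Suc N) \<omega> - bdry \<nu> f N \<omega>) / (- complex_of_real \<omega>) ^ Suc N"
    if "\<omega> > 0" for \<omega>
  proof -
    have "(\<Sum>k\<in>{1..N}. 1 / (- complex_of_real \<omega>) ^ k *
                    ((sigmaT \<nu> f g a b \<xi> (k - 1) b - sigmaT \<nu> f g a b \<xi> (k - 1) \<xi>) / complex_of_real (dI g a b b)
                       * bessel_J (\<nu> + of_nat k) (complex_of_real (\<omega> * g b))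
                     - (sigmaT \<nu> f g a b \<xi> (k - 1) a - sigmaT \<nu> f g a b \<xi> (k - 1) \<xi>) / complex_of_real (dI g a b a)
                       * bessel_J (\<nu> + of_nat k) (complex_of_real (\<omega> * g a))))
      = (\<Sum>k\<in>{1..N}. 1 / (- complex_of_real \<omega>) ^ k * bdry \<nu> f (k - 1) \<omega>)"
      by (intro sum.cong refl) (simp add: bdry_def)
    then show ?thesis using remainder_formula[OF assms(1) that assms(3), of N] by simp
  qed
  show ?thesis
  proof (rule bigoI)
    show "eventually (\<lambda>\<omega>. norm (?R \<omega>) \<le> C * norm (complex_of_real (\<omega> powr (- (real N + 3 / 2))))) at_top"
      using eventually_gt_at_top[of 0]
    proof eventually_elim
      case (elim \<omega>)
      have "norm (?R \<omega>) = norm (sigma_integral \<nu> f (Suc N) \<omega> - bdry \<nu> f N \<omega>) / \<omega> ^ Suc N"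
        unfolding R[OF elim] using elim by (simp only: norm_divide norm_power norm_minus_cancel norm_of_real abs_of_pos)
      also have "\<dots> \<le> C / sqrt \<omega> / \<omega> ^ Suc N"
        using elim C by (intro divide_right_mono) auto
      also have "\<dots> = C * \<omega> powr (- (real N + 3 / 2))"
      proof -
        have "\<omega> powr (real N + 3 / 2) = \<omega> powr (1 / 2) * \<omega> powr real (Suc N)"
          by (subst powr_add[symmetric]) (simp add: add.commute)
        also have "\<dots> = sqrt \<omega> * \<omega> ^ Suc N"
          using elim by (simp only: powr_half_sqrt less_imp_le powr_realpow)
        finally have "\<omega> powr (- (real N + 3 / 2)) = inverse (sqrt \<omega> * \<omega> ^ Suc N)"
          by (simp only: powr_minus)
        then show ?thesis by (simp only: divide_inverse inverse_mult_distrib mult.assoc)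
      qed
      also have "\<omega> powr (- (real N + 3 / 2)) = norm (complex_of_real (\<omega> powr (- (real N + 3 / 2))))"
        by simp
      finally show ?case .
    qed
  qed
qed

end
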